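(* Let $(M,g)=(B\times_f F,\ g_B+f^2g_F)$ be a warped product manifold with $m_1=\dim B$, let $(\overline{M},\overline{g})=(\overline{M}(c),\overline{g})$ be a real space form of constant sectional curvature $c$, and let $\psi:(M,g)\to(\overline{M},\overline{g})$ be an isometric immersion. Assume that $(M,g)$ is a totally geodesic submanifold of $(\overline{M},\overline{g})$. Then $$m_1c\ \le\ \frac{\triangle f}{f}\ \le\ m_1c .$$
   Context: $(B,g_B)$ and $(F,g_F)$ are Riemannian manifolds (of positive dimension), $f:B\to\mathbb{R}^+$ is a smooth positive function (the warping function), and $B\times_f F$ is the product $B\times F$ with the metric $g=g_B+f^2g_F$; $f$ is also regarded as a function on $M$ via the projection to $B$. The Laplacian is $\triangle f=\sum_i\big((\nabla_{v_i}v_i)f-v_i^2f\big)$ for a local orthonormal frame $\{v_i\}$ of $TM$, where $\nabla$ is the Levi-Civita connection of $M$ (note the sign). Totally geodesic means that the second fundamental form of the immersion vanishes identically.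
   Formalization: The Laplacian of f is taken on the base (B, g_B), not on M with a frame of TM: with the latter the claim fails, e.g. for (−π/2,π/2)×_cos S¹ in the unit sphere S², where Δf/f = 1 − tan²t while m₁c = 1. *)

theory Defs
  imports "HOL-Analysis.Analysis"
begin

section \<open>Smooth maps between normed spaces\<close>

text \<open>Intended for open sets in finite-dimensional spaces, where it is enough to let the
  direction \<open>v\<close> be constant in each differentiation.\<close>

primrec Ck_on :: "nat \<Rightarrow> 'a::real_normed_vector set \<Rightarrow> ('a \<Rightarrow> 'b::real_normed_vector) \<Rightarrow> bool" where
  "Ck_on 0 S h \<longleftrightarrow> continuous_on S h"
| "Ck_on (Suc n) S h \<longleftrightarrow>
     (\<forall>x\<in>S. h differentiable at x) \<and> (\<forall>v. Ck_on n S (\<lambda>x. frechet_derivative h (at x) v))"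

definition smooth_on :: "'a::real_normed_vector set \<Rightarrow> ('a \<Rightarrow> 'b::real_normed_vector) \<Rightarrow> bool" where
  "smooth_on S h \<longleftrightarrow> (\<forall>n. Ck_on n S h)"

definition along :: "('a::real_normed_vector \<Rightarrow> 'a) \<Rightarrow> ('a \<Rightarrow> 'b::real_normed_vector) \<Rightarrow> 'a \<Rightarrow> 'b" where
  "along X h x = frechet_derivative h (at x) (X x)"

section \<open>Riemannian manifolds\<close>

text \<open>
  A manifold is an indexed smooth atlas on an open subset (the union of the chart domains) of a
  Hausdorff second countable space \<open>'p\<close>, modelled on the Euclidean space \<open>'e\<close>, so that its
  dimension is \<open>DIM('e)\<close>, which is positive.  A tangent vector at \<open>p\<close> is represented in a chart
  \<open>i\<close> around \<open>p\<close> by a vector of \<open>'e\<close>, and a vector field by a map \<open>'e \<Rightarrow> 'e\<close>; the number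
  \<open>chart_metric M i x v w\<close> is the inner product of the tangent vectors represented
  by \<open>v\<close> and \<open>w\<close> at the point with coordinates \<open>x\<close>.
\<close>

record ('i, 'p, 'e) rmanifold =
  charts :: "'i set"
  chart_dom :: "'i \<Rightarrow> 'p set"
  chart_map :: "'i \<Rightarrow> 'p \<Rightarrow> 'e"
  chart_metric :: "'i \<Rightarrow> 'e \<Rightarrow> 'e \<Rightarrow> 'e \<Rightarrow> real"

definition carrier :: "('i, 'p, 'e) rmanifold \<Rightarrow> 'p set" where
  "carrier M = (\<Union>i\<in>charts M. chart_dom M i)"

definition chart_inv :: "('i, 'p, 'e) rmanifold \<Rightarrow> 'i \<Rightarrow> 'e \<Rightarrow> 'p" where
  "chart_inv M i = inv_into (chart_dom M i) (chart_map M i)"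

definition chart_img :: "('i, 'p, 'e) rmanifold \<Rightarrow> 'i \<Rightarrow> 'e set" where
  "chart_img M i = chart_map M i ` chart_dom M i"

definition smooth_atlas ::
  "('i, 'p::{t2_space, second_countable_topology}, 'e::euclidean_space) rmanifold \<Rightarrow> bool" where
  "smooth_atlas M \<longleftrightarrow>
     (\<forall>i\<in>charts M. open (chart_dom M i) \<and> open (chart_img M i) \<and>
        homeomorphism (chart_dom M i) (chart_img M i) (chart_map M i) (chart_inv M i)) \<and>
     (\<forall>i\<in>charts M. \<forall>j\<in>charts M.
        smooth_on (chart_map M i ` (chart_dom M i \<inter> chart_dom M j)) (chart_map M j \<circ> chart_inv M i))"

text \<open>The last condition is the transformation law making the local metrics a single tensor field.\<close>

definition riemannian_manifold ::
  "('i, 'p::{t2_space, second_countable_topology}, 'e::euclidean_space) rmanifold \<Rightarrow> bool" where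
  "riemannian_manifold M \<longleftrightarrow>
     smooth_atlas M \<and>
     (\<forall>i\<in>charts M. \<forall>x\<in>chart_img M i.
        bilinear (chart_metric M i x) \<and>
        (\<forall>v w. chart_metric M i x v w = chart_metric M i x w v) \<and>
        (\<forall>v. v \<noteq> 0 \<longrightarrow> chart_metric M i x v v > 0)) \<and>
     (\<forall>i\<in>charts M. \<forall>v w. smooth_on (chart_img M i) (\<lambda>x. chart_metric M i x v w)) \<and>
     (\<forall>i\<in>charts M. \<forall>j\<in>charts M. \<forall>p \<in> chart_dom M i \<inter> chart_dom M j. \<forall>v w.
        let T = frechet_derivative (chart_map M j \<circ> chart_inv M i) (at (chart_map M i p))
        in chart_metric M i (chart_map M i p) v w = chart_metric M j (chart_map M j p) (T v) (T w))"

definition smooth_function :: "('i, 'p, 'e::euclidean_space) rmanifold \<Rightarrow> ('p \<Rightarrow> real) \<Rightarrow> bool" where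
  "smooth_function M h \<longleftrightarrow> (\<forall>i\<in>charts M. smooth_on (chart_img M i) (h \<circ> chart_inv M i))"

section \<open>Levi-Civita connection, curvature and Laplacian\<close>

text \<open>The Koszul formula for vector fields that are constant in the chart \<open>i\<close>:
  \<open>christoffel M i x v w = v\<^sup>j w\<^sup>k \<Gamma>\<^sup>l\<^sub>j\<^sub>k(x) \<partial>\<^sub>l\<close>.\<close>

definition christoffel :: "('i, 'p, 'e::euclidean_space) rmanifold \<Rightarrow> 'i \<Rightarrow> 'e \<Rightarrow> 'e \<Rightarrow> 'e \<Rightarrow> 'e" where
  "christoffel M i x v w = (THE z. \<forall>u.
     2 * chart_metric M i x z u =
       frechet_derivative (\<lambda>y. chart_metric M i y w u) (at x) v
     + frechet_derivative (\<lambda>y. chart_metric M i y v u) (at x) w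
     - frechet_derivative (\<lambda>y. chart_metric M i y v w) (at x) u)"

definition levi_civita ::
  "('i, 'p, 'e::euclidean_space) rmanifold \<Rightarrow> 'i \<Rightarrow> ('e \<Rightarrow> 'e) \<Rightarrow> ('e \<Rightarrow> 'e) \<Rightarrow> 'e \<Rightarrow> 'e" where
  "levi_civita M i X Y x = along X Y x + christoffel M i x (X x) (Y x)"

definition lie_bracket :: "('e::real_normed_vector \<Rightarrow> 'e) \<Rightarrow> ('e \<Rightarrow> 'e) \<Rightarrow> 'e \<Rightarrow> 'e" where
  "lie_bracket X Y x = along X Y x - along Y X x"

definition curvature ::
  "('i, 'p, 'e::euclidean_space) rmanifold \<Rightarrow> 'i \<Rightarrow> ('e \<Rightarrow> 'e) \<Rightarrow> ('e \<Rightarrow> 'e) \<Rightarrow> ('e \<Rightarrow> 'e) \<Rightarrow> 'e \<Rightarrow> 'e" where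
  "curvature M i X Y Z x =
     levi_civita M i X (levi_civita M i Y Z) x - levi_civita M i Y (levi_civita M i X Z) x
     - levi_civita M i (lie_bracket X Y) Z x"

text \<open>The curvature is tensorial, so the tangent vectors may be extended by constant fields.\<close>

definition sectional_curvature ::
  "('i, 'p, 'e::euclidean_space) rmanifold \<Rightarrow> 'i \<Rightarrow> 'e \<Rightarrow> 'e \<Rightarrow> 'e \<Rightarrow> real" where
  "sectional_curvature M i x v w =
     chart_metric M i x (curvature M i (\<lambda>_. v) (\<lambda>_. w) (\<lambda>_. w) x) v /
     (chart_metric M i x v v * chart_metric M i x w w - (chart_metric M i x v w)\<^sup>2)"

definition real_space_form ::
  "real \<Rightarrow> ('i, 'p::{t2_space, second_countable_topology}, 'e::euclidean_space) rmanifold \<Rightarrow> bool" where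
  "real_space_form c N \<longleftrightarrow>
     riemannian_manifold N \<and>
     (\<forall>i\<in>charts N. \<forall>x\<in>chart_img N i. \<forall>v w.
        v \<noteq> w \<and> independent {v, w} \<longrightarrow> sectional_curvature N i x v w = c)"

definition local_orthonormal_frame ::
  "('i, 'p, 'e::euclidean_space) rmanifold \<Rightarrow> 'i \<Rightarrow> 'e set \<Rightarrow> (nat \<Rightarrow> 'e \<Rightarrow> 'e) \<Rightarrow> bool" where
  "local_orthonormal_frame M i S e \<longleftrightarrow>
     open S \<and> S \<subseteq> chart_img M i \<and>
     (\<forall>k<DIM('e). smooth_on S (e k)) \<and>
     (\<forall>x\<in>S. \<forall>k<DIM('e). \<forall>l<DIM('e). chart_metric M i x (e k x) (e l x) = (if k = l then 1 else 0))"

text \<open>With this sign the Laplacian is a nonnegative operator.  Its value does not depend on the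
  chart or on the frame, so the choice is immaterial.\<close>

definition laplacian :: "('i, 'p, 'e::euclidean_space) rmanifold \<Rightarrow> ('p \<Rightarrow> real) \<Rightarrow> 'p \<Rightarrow> real" where
  "laplacian M h p = (SOME L. \<exists>i S e.
     i \<in> charts M \<and> p \<in> chart_dom M i \<and> chart_map M i p \<in> S \<and> local_orthonormal_frame M i S e \<and>
     L = (\<Sum>k<DIM('e).
            along (levi_civita M i (e k) (e k)) (h \<circ> chart_inv M i) (chart_map M i p)
          - along (e k) (along (e k) (h \<circ> chart_inv M i)) (chart_map M i p)))"

section \<open>Warped products\<close>

text \<open>The Laplacian of the warping function \<open>f\<close> is \<open>laplacian B f\<close>, taken on the base where \<open>f\<close> lives; the
  Laplacian on the total space of the function \<open>f \<circ> fst\<close> differs from it by a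
  term involving the gradient of \<open>f\<close>.\<close>

definition warped_product ::
  "('i, 'b, 'e) rmanifold \<Rightarrow> ('b \<Rightarrow> real) \<Rightarrow> ('j, 'f, 'k) rmanifold \<Rightarrow>
   ('i \<times> 'j, 'b \<times> 'f, 'e \<times> 'k) rmanifold" where
  "warped_product B f F =
     \<lparr> charts = charts B \<times> charts F,
       chart_dom = (\<lambda>(i, j). chart_dom B i \<times> chart_dom F j),
       chart_map = (\<lambda>(i, j). map_prod (chart_map B i) (chart_map F j)),
       chart_metric = (\<lambda>(i, j) (x, y) (v, v') (w, w').
          chart_metric B i x v w + (f (chart_inv B i x))\<^sup>2 * chart_metric F j y v' w') \<rparr>"

section \<open>Isometric immersions and the second fundamental form\<close>

definition local_dom ::
  "('i, 'p, 'e) rmanifold \<Rightarrow> ('j, 'q, 'k) rmanifold \<Rightarrow> ('p \<Rightarrow> 'q) \<Rightarrow> 'i \<Rightarrow> 'j \<Rightarrow> 'e set" where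
  "local_dom M N \<psi> i j = chart_map M i ` (chart_dom M i \<inter> \<psi> -` chart_dom N j)"

definition local_rep ::
  "('i, 'p, 'e) rmanifold \<Rightarrow> ('j, 'q, 'k) rmanifold \<Rightarrow> ('p \<Rightarrow> 'q) \<Rightarrow> 'i \<Rightarrow> 'j \<Rightarrow> 'e \<Rightarrow> 'k" where
  "local_rep M N \<psi> i j = chart_map N j \<circ> \<psi> \<circ> chart_inv M i"

definition smooth_map ::
  "('i, 'p::topological_space, 'e::euclidean_space) rmanifold \<Rightarrow>
   ('j, 'q::topological_space, 'k::euclidean_space) rmanifold \<Rightarrow> ('p \<Rightarrow> 'q) \<Rightarrow> bool" where
  "smooth_map M N \<psi> \<longleftrightarrow>
     \<psi> ` carrier M \<subseteq> carrier N \<and> continuous_on (carrier M) \<psi> \<and>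
     (\<forall>i\<in>charts M. \<forall>j\<in>charts N. smooth_on (local_dom M N \<psi> i j) (local_rep M N \<psi> i j))"

definition isometric_immersion ::
  "('i, 'p::topological_space, 'e::euclidean_space) rmanifold \<Rightarrow>
   ('j, 'q::topological_space, 'k::euclidean_space) rmanifold \<Rightarrow> ('p \<Rightarrow> 'q) \<Rightarrow> bool" where
  "isometric_immersion M N \<psi> \<longleftrightarrow>
     smooth_map M N \<psi> \<and>
     (\<forall>i\<in>charts M. \<forall>j\<in>charts N. \<forall>x\<in>local_dom M N \<psi> i j.
        let D = frechet_derivative (local_rep M N \<psi> i j) (at x)
        in inj D \<and>
           (\<forall>v w. chart_metric N j (local_rep M N \<psi> i j x) (D v) (D w) = chart_metric M i x v w))"

text \<open>The derivative, in the direction \<open>X\<close>, of a vector field \<open>W\<close> along \<open>\<psi>\<close> with respect to the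
  Levi-Civita connection of the target.\<close>

definition levi_civita_along ::
  "('i, 'p, 'e::euclidean_space) rmanifold \<Rightarrow> ('j, 'q, 'k::euclidean_space) rmanifold \<Rightarrow>
   ('p \<Rightarrow> 'q) \<Rightarrow> 'i \<Rightarrow> 'j \<Rightarrow> ('e \<Rightarrow> 'e) \<Rightarrow> ('e \<Rightarrow> 'k) \<Rightarrow> 'e \<Rightarrow> 'k" where
  "levi_civita_along M N \<psi> i j X W x =
     along X W x +
     christoffel N j (local_rep M N \<psi> i j x) (along X (local_rep M N \<psi> i j) x) (W x)"

text \<open>The second fundamental form according to the Gauss formula
  \<open>\<nabla>'\<^sub>X(\<psi>\<^sub>*Y) = \<psi>\<^sub>*(\<nabla>\<^sub>XY) + h(X,Y)\<close>; for an isometric immersion this is the normal component of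
  \<open>\<nabla>'\<^sub>X(\<psi>\<^sub>*Y)\<close>.\<close>

definition second_fundamental_form ::
  "('i, 'p, 'e::euclidean_space) rmanifold \<Rightarrow> ('j, 'q, 'k::euclidean_space) rmanifold \<Rightarrow>
   ('p \<Rightarrow> 'q) \<Rightarrow> 'i \<Rightarrow> 'j \<Rightarrow> ('e \<Rightarrow> 'e) \<Rightarrow> ('e \<Rightarrow> 'e) \<Rightarrow> 'e \<Rightarrow> 'k" where
  "second_fundamental_form M N \<psi> i j X Y x =
     levi_civita_along M N \<psi> i j X (along Y (local_rep M N \<psi> i j)) x
     - along (levi_civita M i X Y) (local_rep M N \<psi> i j) x"

definition totally_geodesic ::
  "('i, 'p, 'e::euclidean_space) rmanifold \<Rightarrow> ('j, 'q, 'k::euclidean_space) rmanifold \<Rightarrow>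
   ('p \<Rightarrow> 'q) \<Rightarrow> bool" where
  "totally_geodesic M N \<psi> \<longleftrightarrow>
     (\<forall>i\<in>charts M. \<forall>j\<in>charts N. \<forall>S X Y.
        open S \<and> S \<subseteq> local_dom M N \<psi> i j \<and> smooth_on S X \<and> smooth_on S Y \<longrightarrow>
        (\<forall>x\<in>S. second_fundamental_form M N \<psi> i j X Y x = 0))"

end

theory Submission
  imports Defs
begin

text \<open>
  Let \<open>V\<close> be a nonzero constant vertical field and \<open>X\<close> a constant horizontal field in a product
  chart, and let \<open>r\<close> be the immersion in coordinates. In a warped product
  \<open>\<nabla>\<^sub>X V = (X f / f) V\<close> and \<open>\<nabla>\<^sub>X X\<close> is the horizontal lift of the same field on the base. Hence a
  vanishing second fundamental form expresses the second derivatives of \<open>r\<close> in the directions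
  \<open>(X, X)\<close> and \<open>(V, X)\<close> through \<open>f\<close>, the base connection and the connection of the ambient space,
  and equality of the mixed derivatives \<open>\<partial>\<^sub>V \<partial>\<^sub>X (Dr X) = \<partial>\<^sub>X \<partial>\<^sub>V (Dr X)\<close> turns into
  \<open>R(Dr V, Dr X) Dr X = - (Hess f (X, X) / f) Dr V\<close> for the ambient curvature \<open>R\<close>, without
  computing any curvature of the warped product. Constant curvature \<open>c\<close> gives
  \<open>- Hess f (X, X) = c f |X|\<^sup>2\<close>, and the sum over an orthonormal frame of the base is the Laplacian.
\<close>

subsection \<open>Smooth maps\<close>

text \<open>Since \<open>S\<close> is open, the two functions agree near each point of
  \<open>S\<close>, so their derivatives there coincide and the induction can continue with the
  directional derivatives.\<close>

lemma Ck_on_cong: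
  assumes "open S" "\<And>x. x \<in> S \<Longrightarrow> h x = k x" "Ck_on n S h"
  shows "Ck_on n S k"
  using assms(2,3)
proof (induction n arbitrary: h k)
  case 0
  then show ?case by (simp cong: continuous_on_cong)
next
  case (Suc n)
  have der: "(k has_derivative frechet_derivative h (at x)) (at x)" if "x \<in> S" for x
  proof (rule has_derivative_transform_within_open[OF _ \<open>open S\<close> that])
    show "(h has_derivative frechet_derivative h (at x)) (at x)"
      using Suc.prems(2) that by (simp add: frechet_derivative_works)
  qed (use Suc.prems(1) in auto)
  have eq: "frechet_derivative h (at x) = frechet_derivative k (at x)" if "x \<in> S" for x
    using frechet_derivative_at[OF der[OF that]] .
  have "Ck_on n S (\<lambda>x. frechet_derivative k (at x) v)" for v
    by (rule Suc.IH[of "\<lambda>x. frechet_derivative h (at x) v"]) (use eq Suc.prems in auto)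
  moreover have "k differentiable at x" if "x \<in> S" for x
    using der[OF that] by (auto simp: differentiable_def)
  ultimately show ?case by simp
qed

lemma smooth_on_cong:
  assumes "open S" "\<And>x. x \<in> S \<Longrightarrow> h x = k x" "smooth_on S h"
  shows "smooth_on S k"
  using Ck_on_cong[OF assms(1,2)] assms(3) by (auto simp: smooth_on_def)

lemma Ck_on_Suc_imp: "Ck_on (Suc n) S h \<Longrightarrow> Ck_on n S h"
proof (induction n arbitrary: h)
  case 0
  then show ?case
    by (simp add: continuous_at_imp_continuous_on differentiable_imp_continuous_within)
next
  case (Suc n)
  then show ?case by (metis Ck_on.simps(2))
qed

lemma smooth_on_imp_differentiable: "smooth_on S h \<Longrightarrow> x \<in> S \<Longrightarrow> h differentiable at x"
  unfolding smooth_on_def by (metis Ck_on.simps(2))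

lemma smooth_on_imp_has_derivative:
  "smooth_on S h \<Longrightarrow> x \<in> S \<Longrightarrow> (h has_derivative frechet_derivative h (at x)) (at x)"
  using smooth_on_imp_differentiable frechet_derivative_works by blast

lemma smooth_on_imp_continuous_on: "smooth_on S h \<Longrightarrow> continuous_on S h"
  unfolding smooth_on_def by (metis Ck_on.simps(1))

lemma smooth_on_frechet_derivative:
  "smooth_on S h \<Longrightarrow> smooth_on S (\<lambda>x. frechet_derivative h (at x) v)"
  unfolding smooth_on_def by (metis Ck_on.simps(2))

lemma linear_frechet_derivative_smooth_on:
  "smooth_on S h \<Longrightarrow> x \<in> S \<Longrightarrow> linear (frechet_derivative h (at x))"
  using linear_frechet_derivative smooth_on_imp_differentiable by blast

lemma Ck_on_const: "Ck_on n S (\<lambda>x. c)"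
  by (induction n arbitrary: c) auto

lemma smooth_on_const: "smooth_on S (\<lambda>x. c)"
  by (simp add: smooth_on_def Ck_on_const)

lemma frechet_derivative_eqI:
  "(h has_derivative h') (at x) \<Longrightarrow> frechet_derivative h (at x) = h'"
  using frechet_derivative_at by metis

lemma Ck_on_add:
  assumes "open S" "Ck_on n S h" "Ck_on n S k"
  shows "Ck_on n S (\<lambda>x. h x + k x)"
  using assms(2,3)
proof (induction n arbitrary: h k)
  case 0
  then show ?case by (simp add: continuous_on_add)
next
  case (Suc n)
  have eq: "frechet_derivative (\<lambda>x. h x + k x) (at x) v =
      frechet_derivative h (at x) v + frechet_derivative k (at x) v" if "x \<in> S" for x v
    using Suc.prems that
    by (subst frechet_derivative_eqI[OF has_derivative_add])
      (auto simp: frechet_derivative_works[symmetric])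
  have "Ck_on n S (\<lambda>x. frechet_derivative (\<lambda>x. h x + k x) (at x) v)" for v
    by (rule Ck_on_cong[OF assms(1) _ Suc.IH[of "\<lambda>x. frechet_derivative h (at x) v"
            "\<lambda>x. frechet_derivative k (at x) v"]])
      (use eq Suc.prems in auto)
  with Suc.prems show ?case by (auto intro!: derivative_intros)
qed

text \<open>The product rule, proved once for multiplication, scaling and inner products. Each
  Leibniz term keeps one factor undifferentiated, so that factor is first lowered by one order with
  \<open>Ck_on_Suc_imp\<close>.\<close>

lemma (in bounded_bilinear) Ck_on:
  assumes "open S" "Ck_on n S h" "Ck_on n S k"
  shows "Ck_on n S (\<lambda>x. prod (h x) (k x))"
  using assms(2,3)
proof (induction n arbitrary: h k)
  case 0
  then show ?case by (simp add: continuous_on)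
next
  case (Suc n)
  have der: "((\<lambda>x. prod (h x) (k x)) has_derivative
      (\<lambda>v. prod (h x) (frechet_derivative k (at x) v) + prod (frechet_derivative h (at x) v) (k x)))
      (at x)" if "x \<in> S" for x
    using Suc.prems that by (intro FDERIV) (auto simp: frechet_derivative_works[symmetric])
  have "Ck_on n S (\<lambda>x. prod (h x) (frechet_derivative k (at x) v)
      + prod (frechet_derivative h (at x) v) (k x))" for v
    using Suc.prems Ck_on_Suc_imp[OF Suc.prems(1)] Ck_on_Suc_imp[OF Suc.prems(2)]
    by (intro Ck_on_add[OF assms(1)] Suc.IH) auto
  then have "Ck_on n S (\<lambda>x. frechet_derivative (\<lambda>x. prod (h x) (k x)) (at x) v)" for v
    by (rule Ck_on_cong[OF assms(1), rotated]) (simp add: frechet_derivative_eqI[OF der])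
  with der show ?case by (auto simp: differentiable_def)
qed

lemma smooth_on_add:
  "open S \<Longrightarrow> smooth_on S h \<Longrightarrow> smooth_on S k \<Longrightarrow> smooth_on S (\<lambda>x. h x + k x)"
  by (simp add: smooth_on_def Ck_on_add)

lemma smooth_on_mult:
  fixes h k :: "'a::real_normed_vector \<Rightarrow> 'b::real_normed_algebra"
  shows "open S \<Longrightarrow> smooth_on S h \<Longrightarrow> smooth_on S k \<Longrightarrow> smooth_on S (\<lambda>x. h x * k x)"
  by (simp add: smooth_on_def bounded_bilinear.Ck_on[OF bounded_bilinear_mult])

lemma smooth_on_scaleR:
  "open S \<Longrightarrow> smooth_on S h \<Longrightarrow> smooth_on S k \<Longrightarrow> smooth_on S (\<lambda>x. h x *\<^sub>R k x)"
  by (simp add: smooth_on_def bounded_bilinear.Ck_on[OF bounded_bilinear_scaleR])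

lemma smooth_on_inner_left:
  "open S \<Longrightarrow> smooth_on S h \<Longrightarrow> smooth_on S (\<lambda>x. h x \<bullet> c)"
  by (simp add: smooth_on_def bounded_bilinear.Ck_on[OF bounded_bilinear_inner] Ck_on_const)

lemma smooth_on_sum:
  assumes "open S" "\<And>i. i \<in> I \<Longrightarrow> smooth_on S (h i)"
  shows "smooth_on S (\<lambda>x. \<Sum>i\<in>I. h i x)"
  using assms(2)
  by (induction I rule: infinite_finite_induct) (auto intro: smooth_on_const smooth_on_add[OF assms(1)])

lemma smooth_on_uminus: "open S \<Longrightarrow> smooth_on S h \<Longrightarrow> smooth_on S (\<lambda>x. - h x)"
  using smooth_on_scaleR[OF _ smooth_on_const, of S h "-1"] by simp

lemma smooth_on_diff:
  "open S \<Longrightarrow> smooth_on S h \<Longrightarrow> smooth_on S k \<Longrightarrow> smooth_on S (\<lambda>x. h x - k x)"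
  using smooth_on_add[OF _ _ smooth_on_uminus, of S h k] by simp

text \<open>The derivative is a constant times the cube of the function itself times the derivative
  of \<open>u\<close>, so the induction hypothesis for the same function controls the next order.
  This is the normalising factor in Gram-Schmidt.\<close>

lemma smooth_on_inverse_sqrt:
  fixes u :: "'a::real_normed_vector \<Rightarrow> real"
  assumes "open S" "smooth_on S u" "\<And>x. x \<in> S \<Longrightarrow> u x > 0"
  shows "smooth_on S (\<lambda>x. inverse (sqrt (u x)))"
proof -
  have der: "((\<lambda>x. inverse (sqrt (u x))) has_derivative
      (\<lambda>v. (- 1 / 2) * (inverse (sqrt (u x)) * (inverse (sqrt (u x)) * inverse (sqrt (u x)))) *
          frechet_derivative u (at x) v)) (at x)" if "x \<in> S" for x
    using assms(3)[OF that]
    by (auto intro!: derivative_eq_intros smooth_on_imp_has_derivative[OF assms(2) that]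
        simp: field_simps)
  have "Ck_on n S (\<lambda>x. inverse (sqrt (u x)))" for n
  proof (induction n)
    case 0
    then show ?case
      using assms(3) smooth_on_imp_continuous_on[OF assms(2)]
      by (force intro!: continuous_intros)
  next
    case (Suc n)
    have u': "Ck_on n S (\<lambda>x. frechet_derivative u (at x) v)" for v
      using smooth_on_frechet_derivative[OF assms(2)] by (simp add: smooth_on_def)
    have "Ck_on n S (\<lambda>x. frechet_derivative (\<lambda>x. inverse (sqrt (u x))) (at x) v)" for v
    proof (rule Ck_on_cong[OF assms(1)])
      show "Ck_on n S (\<lambda>x. (- 1 / 2) *
          (inverse (sqrt (u x)) * (inverse (sqrt (u x)) * inverse (sqrt (u x)))) *
          frechet_derivative u (at x) v)"
        by (intro bounded_bilinear.Ck_on[OF bounded_bilinear_mult] assms(1) Suc u' Ck_on_const)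
    qed (simp add: frechet_derivative_eqI[OF der])
    with der show ?case by (auto simp: differentiable_def)
  qed
  then show ?thesis by (simp add: smooth_on_def)
qed

section \<open>Symmetry of second derivatives through the mean value theorem\<close>

lemma real_mvt_line:
  fixes h :: "'a::real_normed_vector \<Rightarrow> real"
  assumes "t > 0" "\<And>s. 0 \<le> s \<Longrightarrow> s \<le> t \<Longrightarrow> h differentiable at (x + s *\<^sub>R v)"
  obtains s where "0 < s" "s < t"
    "h (x + t *\<^sub>R v) - h x = t * frechet_derivative h (at (x + s *\<^sub>R v)) v"
proof -
  have der: "((\<lambda>s. h (x + s *\<^sub>R v)) has_derivative
      (\<lambda>d. frechet_derivative h (at (x + s *\<^sub>R v)) (d *\<^sub>R v))) (at s within {0..t})"
    if "0 \<le> s" "s \<le> t" for s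
    by (rule has_derivative_at_withinI, rule has_derivative_compose[of "\<lambda>s. x + s *\<^sub>R v"])
      (use assms(2)[OF that] in \<open>auto intro!: derivative_eq_intros simp: frechet_derivative_works\<close>)
  obtain s where s: "s \<in> {0<..<t}"
    "h (x + t *\<^sub>R v) - h (x + 0 *\<^sub>R v) =
      frechet_derivative h (at (x + s *\<^sub>R v)) ((t - 0) *\<^sub>R v)"
    using mvt_simple[OF assms(1) der] by blast
  moreover have "linear (frechet_derivative h (at (x + s *\<^sub>R v)))"
    using assms(2) s(1) by (intro linear_frechet_derivative) auto
  ultimately show ?thesis
    using that[of s] by (simp add: linear_cmul)
qed

lemma real_second_difference:
  fixes h :: "'a::real_normed_vector \<Rightarrow> real"
  assumes h: "smooth_on S h" and "t > 0"
    and S: "\<And>r s. 0 \<le> r \<Longrightarrow> r \<le> t \<Longrightarrow> 0 \<le> s \<Longrightarrow> s \<le> t \<Longrightarrow> x + r *\<^sub>R u + s *\<^sub>R v \<in> S"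
  obtains r s where "0 < r" "r < t" "0 < s" "s < t"
    "h (x + t *\<^sub>R u + t *\<^sub>R v) - h (x + t *\<^sub>R u) - h (x + t *\<^sub>R v) + h x =
      t * t * frechet_derivative (\<lambda>y. frechet_derivative h (at y) u) (at (x + r *\<^sub>R u + s *\<^sub>R v)) v"
proof -
  \<comment> \<open>The second difference over the parallelogram is a difference of \<open>k\<close>
    in direction \<open>u\<close>; the mean value theorem is applied to \<open>k\<close> along
    \<open>u\<close>, and then along \<open>v\<close> to the derivative of \<open>h\<close> in
    direction \<open>u\<close>.\<close>
  define k where "k = (\<lambda>y. h (y + t *\<^sub>R v) - h y)"
  have k: "(k has_derivative (\<lambda>w. frechet_derivative h (at (y + t *\<^sub>R v)) w
      - frechet_derivative h (at y) w)) (at y)" if "y \<in> S" "y + t *\<^sub>R v \<in> S" for y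
    unfolding k_def
    by (rule has_derivative_diff, rule has_derivative_compose[of "\<lambda>y. y + t *\<^sub>R v"])
      (auto intro!: derivative_eq_intros smooth_on_imp_has_derivative[OF h] that)
  have in_S: "x + r *\<^sub>R u \<in> S" "x + r *\<^sub>R u + t *\<^sub>R v \<in> S" if "0 \<le> r" "r \<le> t" for r
    using S[of r 0] S[of r t] that \<open>t > 0\<close> by auto
  have "k differentiable at (x + r *\<^sub>R u)" if "0 \<le> r" "r \<le> t" for r
    using k[OF in_S[OF that]] by (auto simp: differentiable_def)
  then obtain r where r: "0 < r" "r < t"
    "k (x + t *\<^sub>R u) - k x = t * frechet_derivative k (at (x + r *\<^sub>R u)) u"
    using real_mvt_line[OF \<open>t > 0\<close>, of k x u] by blast
  have k': "frechet_derivative k (at (x + r *\<^sub>R u)) u =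
      frechet_derivative h (at (x + r *\<^sub>R u + t *\<^sub>R v)) u - frechet_derivative h (at (x + r *\<^sub>R u)) u"
    using frechet_derivative_eqI[OF k] in_S[of r] r by simp
  have "(\<lambda>y. frechet_derivative h (at y) u) differentiable at (x + r *\<^sub>R u + s *\<^sub>R v)"
    if "0 \<le> s" "s \<le> t" for s
    using S[of r s] that r
    by (intro smooth_on_imp_differentiable[OF smooth_on_frechet_derivative[OF h]]) auto
  then obtain s where s: "0 < s" "s < t"
    "frechet_derivative h (at (x + r *\<^sub>R u + t *\<^sub>R v)) u - frechet_derivative h (at (x + r *\<^sub>R u)) u
      = t * frechet_derivative (\<lambda>y. frechet_derivative h (at y) u) (at (x + r *\<^sub>R u + s *\<^sub>R v)) v"
    using real_mvt_line[OF \<open>t > 0\<close>, of "\<lambda>y. frechet_derivative h (at y) u" "x + r *\<^sub>R u" v] by blast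
  have "h (x + t *\<^sub>R u + t *\<^sub>R v) - h (x + t *\<^sub>R u) - h (x + t *\<^sub>R v) + h x = k (x + t *\<^sub>R u) - k x"
    by (simp add: k_def)
  then show ?thesis
    using that[OF r(1,2) s(1,2)] unfolding r(3) k' s(3) by (simp only: mult.assoc)
qed

text \<open>The second difference is symmetric in \<open>u\<close> and \<open>v\<close>, so mixed
  derivatives in the two orders take a common value at points arbitrarily close to \<open>x\<close>.
  Continuity then excludes different values at \<open>x\<close>.\<close>

lemma real_second_derivative_symmetric:
  fixes h :: "'a::real_normed_vector \<Rightarrow> real"
  assumes S: "open S" "x \<in> S" and h: "smooth_on S h"
  shows "frechet_derivative (\<lambda>y. frechet_derivative h (at y) u) (at x) v =
    frechet_derivative (\<lambda>y. frechet_derivative h (at y) v) (at x) u"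
proof (rule ccontr)
  define P where "P = (\<lambda>u v x. frechet_derivative (\<lambda>y. frechet_derivative h (at y) u) (at x) v)"
  assume "\<not> ?thesis"
  then have ne: "P u v x \<noteq> P v u x" by (simp add: P_def)
  have cont: "continuous_on S (P u v)" for u v
    unfolding P_def
    by (intro smooth_on_imp_continuous_on smooth_on_frechet_derivative h)
  have tend: "(P u v \<longlongrightarrow> P u v x) (at x)" for u v
    using cont[of u v] S by (simp add: continuous_on_eq_continuous_at isCont_def)
  \<comment> \<open>Half the gap: a common value cannot be strictly within \<open>e\<close> of both
    mixed derivatives at \<open>x\<close>.\<close>
  define e where "e = \<bar>P u v x - P v u x\<bar> / 2"
  have "e > 0" using ne by (simp add: e_def)
  have near: "\<exists>d>0. \<forall>y. dist y x < d \<longrightarrow> y \<in> S \<and> dist (P u v y) (P u v x) < e" for u v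
  proof -
    have "eventually (\<lambda>y. y \<in> S) (nhds x)"
      using S by (rule eventually_nhds_in_open)
    moreover have "eventually (\<lambda>y. dist (P u v y) (P u v x) < e) (nhds x)"
      using tendstoD[OF tend \<open>e > 0\<close>, of u v]
      unfolding eventually_at_filter by (rule eventually_mono) (use \<open>e > 0\<close> in auto)
    ultimately have "eventually (\<lambda>y. y \<in> S \<and> dist (P u v y) (P u v x) < e) (nhds x)"
      by (rule eventually_conj)
    then show ?thesis
      by (simp add: eventually_nhds_metric)
  qed
  obtain d1 d2 where d: "d1 > 0" "\<And>y. dist y x < d1 \<Longrightarrow> y \<in> S \<and> dist (P u v y) (P u v x) < e"
    "d2 > 0" "\<And>y. dist y x < d2 \<Longrightarrow> y \<in> S \<and> dist (P v u y) (P v u x) < e"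
    using near[of u v] near[of v u] by blast
  \<comment> \<open>The summand 1 keeps the denominator positive when both directions vanish, and
    makes the bound on the parallelogram strict.\<close>
  define t where "t = min d1 d2 / (norm u + norm v + 1)"
  have t: "t > 0" using d by (simp add: t_def add_nonneg_pos)
  have close: "dist (x + r *\<^sub>R u + s *\<^sub>R v) x < min d1 d2"
    if "0 \<le> r" "r \<le> t" "0 \<le> s" "s \<le> t" for r s
  proof -
    have "norm (r *\<^sub>R u + s *\<^sub>R v) \<le> r * norm u + s * norm v"
      using that by (intro norm_triangle_le) auto
    also have "\<dots> \<le> t * norm u + t * norm v"
      using that by (intro add_mono mult_right_mono) auto
    also have "\<dots> < t * (norm u + norm v + 1)"
      using t by (simp add: algebra_simps)
    also have "\<dots> = min d1 d2"
      using add_nonneg_pos[of "norm u + norm v" 1] by (simp add: t_def)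
    finally show ?thesis by (simp add: dist_norm add.assoc)
  qed
  obtain r s where rs: "0 < r" "r < t" "0 < s" "s < t"
    "h (x + t *\<^sub>R u + t *\<^sub>R v) - h (x + t *\<^sub>R u) - h (x + t *\<^sub>R v) + h x =
      t * t * P u v (x + r *\<^sub>R u + s *\<^sub>R v)"
    unfolding P_def
    by (rule real_second_difference[OF h t, of x u v]) (use close d in auto)
  have close': "dist (x + r *\<^sub>R v + s *\<^sub>R u) x < min d1 d2"
    if "0 \<le> r" "r \<le> t" "0 \<le> s" "s \<le> t" for r s
    using close[of s r] that by (simp add: algebra_simps)
  obtain r' s' where rs': "0 < r'" "r' < t" "0 < s'" "s' < t"
    "h (x + t *\<^sub>R v + t *\<^sub>R u) - h (x + t *\<^sub>R v) - h (x + t *\<^sub>R u) + h x =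
      t * t * P v u (x + r' *\<^sub>R v + s' *\<^sub>R u)"
    unfolding P_def
    by (rule real_second_difference[OF h t, of x v u]) (use close' d in auto)
  have "h (x + t *\<^sub>R u + t *\<^sub>R v) = h (x + t *\<^sub>R v + t *\<^sub>R u)" by (simp add: algebra_simps)
  with rs(5) rs'(5) have "t * t * P u v (x + r *\<^sub>R u + s *\<^sub>R v) = t * t * P v u (x + r' *\<^sub>R v + s' *\<^sub>R u)"
    by linarith
  with t have eq: "P u v (x + r *\<^sub>R u + s *\<^sub>R v) = P v u (x + r' *\<^sub>R v + s' *\<^sub>R u)" by simp
  have "dist (P u v (x + r *\<^sub>R u + s *\<^sub>R v)) (P u v x) < e"
    using d(2) close[of r s] rs by simp
  moreover have "dist (P v u (x + r' *\<^sub>R v + s' *\<^sub>R u)) (P v u x) < e"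
    using d(4) close'[of r' s'] rs' by simp
  ultimately show False
    unfolding eq e_def dist_real_def by (smt (verit) field_sum_of_halves)
qed

text \<open>Reduction to real functions by taking the inner product with each basis vector, which
  commutes with both differentiations.\<close>

lemma second_derivative_symmetric:
  fixes h :: "'a::real_normed_vector \<Rightarrow> 'b::euclidean_space"
  assumes S: "open S" "x \<in> S" and h: "smooth_on S h"
  shows "frechet_derivative (\<lambda>y. frechet_derivative h (at y) u) (at x) v =
    frechet_derivative (\<lambda>y. frechet_derivative h (at y) v) (at x) u"
proof (rule euclidean_eqI)
  fix b :: 'b assume "b \<in> Basis"
  have der1: "frechet_derivative (\<lambda>y. k y \<bullet> b) (at y) w = frechet_derivative k (at y) w \<bullet> b"
    if "smooth_on S k" "y \<in> S" for k :: "'a \<Rightarrow> 'b" and y w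
    by (subst frechet_derivative_eqI[OF has_derivative_inner_left])
      (use smooth_on_imp_has_derivative[OF that] in auto)
  have der2: "frechet_derivative (\<lambda>y. frechet_derivative (\<lambda>y. h y \<bullet> b) (at y) u) (at x) v =
      frechet_derivative (\<lambda>y. frechet_derivative h (at y) u) (at x) v \<bullet> b" for u v
  proof -
    have "frechet_derivative (\<lambda>y. frechet_derivative (\<lambda>y. h y \<bullet> b) (at y) u) (at x) =
        frechet_derivative (\<lambda>y. frechet_derivative h (at y) u \<bullet> b) (at x)"
      by (rule sym, rule frechet_derivative_transform_within_open[OF _ S])
        (auto intro!: smooth_on_imp_differentiable[OF _ S(2)] smooth_on_inner_left S h
          smooth_on_frechet_derivative der1[symmetric])
    then show ?thesis
      using der1[OF smooth_on_frechet_derivative[OF h] S(2)] by simp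
  qed
  show "frechet_derivative (\<lambda>y. frechet_derivative h (at y) u) (at x) v \<bullet> b =
    frechet_derivative (\<lambda>y. frechet_derivative h (at y) v) (at x) u \<bullet> b"
    using real_second_derivative_symmetric[OF S smooth_on_inner_left[OF S(1) h, of b], of u v]
    by (simp add: der2)
qed

section \<open>Pointwise linear maps applied to moving vectors\<close>

lemma linear_eq_sum_Basis:
  fixes L :: "'a::euclidean_space \<Rightarrow> 'b::real_vector"
  assumes "linear L"
  shows "L v = (\<Sum>b\<in>Basis. (v \<bullet> b) *\<^sub>R L b)"
proof -
  have "L v = L (\<Sum>b\<in>Basis. (v \<bullet> b) *\<^sub>R b)"
    by (simp add: euclidean_representation)
  then show ?thesis
    by (simp add: linear_sum[OF assms] linear_cmul[OF assms])
qed

text \<open>A Leibniz rule: first the vector is frozen at \<open>Y x\<close>, then the map at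
  \<open>A x\<close>. Expanding \<open>Y y\<close> in the standard basis reduces everything to the
  functions \<open>A y b\<close> with \<open>b\<close> fixed, so no norm on the space of linear maps
  enters.\<close>

lemma has_derivative_linear_family:
  fixes A :: "'a::real_normed_vector \<Rightarrow> 'b::euclidean_space \<Rightarrow> 'c::real_normed_vector"
  assumes S: "open S" "x \<in> S" and lin: "\<And>y. y \<in> S \<Longrightarrow> linear (A y)"
    and A: "\<And>v. (\<lambda>y. A y v) differentiable at x"
    and Y: "(Y has_derivative Y') (at x)"
  shows "((\<lambda>y. A y (Y y)) has_derivative
    (\<lambda>u. frechet_derivative (\<lambda>y. A y (Y x)) (at x) u + A x (Y' u))) (at x)"
proof -
  note expand = linear_eq_sum_Basis[OF lin]
  define A' where "A' = (\<lambda>b. frechet_derivative (\<lambda>y. A y b) (at x))"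
  have A': "((\<lambda>y. A y b) has_derivative A' b) (at x)" for b
    using A[of b] by (simp add: A'_def frechet_derivative_works)
  have sums: "((\<lambda>y. A y (Z y)) has_derivative
      (\<lambda>u. \<Sum>b\<in>Basis. (Z x \<bullet> b) *\<^sub>R A' b u + (Z' u \<bullet> b) *\<^sub>R A x b)) (at x)"
    if "(Z has_derivative Z') (at x)" for Z Z'
  proof (rule has_derivative_transform_within_open[OF _ S])
    show "((\<lambda>y. \<Sum>b\<in>Basis. (Z y \<bullet> b) *\<^sub>R A y b) has_derivative
      (\<lambda>u. \<Sum>b\<in>Basis. (Z x \<bullet> b) *\<^sub>R A' b u + (Z' u \<bullet> b) *\<^sub>R A x b)) (at x)"
      by (intro has_derivative_sum has_derivative_scaleR has_derivative_inner_left that A')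
  qed (rule expand[symmetric])
  \<comment> \<open>The same expansion for the constant field with value \<open>Y x\<close>
    identifies the first half of the sum.\<close>
  have "frechet_derivative (\<lambda>y. A y (Y x)) (at x) = (\<lambda>u. \<Sum>b\<in>Basis. (Y x \<bullet> b) *\<^sub>R A' b u)"
    using frechet_derivative_eqI[OF sums[OF has_derivative_const[of "Y x"]]] by simp
  with sums[OF Y] show ?thesis
    by (simp add: sum.distrib expand[OF S(2), of "Y' _"])
qed

lemma smooth_on_linear_family:
  fixes A :: "'a::real_normed_vector \<Rightarrow> 'b::euclidean_space \<Rightarrow> 'c::real_normed_vector"
  assumes S: "open S" and lin: "\<And>y. y \<in> S \<Longrightarrow> linear (A y)"
    and A: "\<And>v. smooth_on S (\<lambda>y. A y v)" and Y: "smooth_on S Y"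
  shows "smooth_on S (\<lambda>y. A y (Y y))"
proof (rule smooth_on_cong[OF S])
  show "smooth_on S (\<lambda>y. \<Sum>b\<in>Basis. (Y y \<bullet> b) *\<^sub>R A y b)"
    by (intro smooth_on_sum smooth_on_scaleR smooth_on_inner_left S A Y)
  show "(\<Sum>b\<in>Basis. (Y y \<bullet> b) *\<^sub>R A y b) = A y (Y y)" if "y \<in> S" for y
    by (rule linear_eq_sum_Basis[OF lin[OF that], symmetric])
qed

subsection \<open>Orthonormal frames and Christoffel symbols in a chart\<close>

text \<open>Uniqueness for the definite description: two solutions differ by a vector whose pairing
  with itself is zero, and the metric is positive definite. Christoffel symbols can then be found by
  guessing and checking the Koszul identity.\<close>

lemma christoffel_eqI:
  assumes "bilinear (chart_metric M i x)" "\<And>v. v \<noteq> 0 \<Longrightarrow> chart_metric M i x v v > 0"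
    and z: "\<And>u. 2 * chart_metric M i x z u =
       frechet_derivative (\<lambda>y. chart_metric M i y w u) (at x) v
     + frechet_derivative (\<lambda>y. chart_metric M i y v u) (at x) w
     - frechet_derivative (\<lambda>y. chart_metric M i y v w) (at x) u"
  shows "christoffel M i x v w = z"
  unfolding christoffel_def
proof (rule the_equality)
  show "z' = z" if "\<forall>u. 2 * chart_metric M i x z' u =
       frechet_derivative (\<lambda>y. chart_metric M i y w u) (at x) v
     + frechet_derivative (\<lambda>y. chart_metric M i y v u) (at x) w
     - frechet_derivative (\<lambda>y. chart_metric M i y v w) (at x) u" for z'
  proof -
    have "chart_metric M i x (z' - z) (z' - z) = 0"
      using spec[OF that, of "z' - z"] z[of "z' - z"] by (simp add: bilinear_lsub[OF assms(1)])
    with assms(2)[of "z' - z"] show ?thesis by force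
  qed
qed (use z in blast)

locale riemannian_chart =
  fixes M :: "('i, 'p, 'e::euclidean_space) rmanifold" and i :: 'i
  assumes open_img: "open (chart_img M i)"
    and bilinear: "x \<in> chart_img M i \<Longrightarrow> bilinear (chart_metric M i x)"
    and sym: "x \<in> chart_img M i \<Longrightarrow> chart_metric M i x v w = chart_metric M i x w v"
    and pos: "x \<in> chart_img M i \<Longrightarrow> v \<noteq> 0 \<Longrightarrow> chart_metric M i x v v > 0"
    and smooth: "smooth_on (chart_img M i) (\<lambda>x. chart_metric M i x v w)"
begin

abbreviation S where "S \<equiv> chart_img M i"
abbreviation g where "g \<equiv> chart_metric M i"
abbreviation \<Gamma> where "\<Gamma> \<equiv> christoffel M i"

lemma linear_left: "x \<in> S \<Longrightarrow> linear (\<lambda>v. g x v w)"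
  and linear_right: "x \<in> S \<Longrightarrow> linear (g x v)"
  using bilinear by (simp_all add: bilinear_def)

lemma metric_eqI:
  assumes "x \<in> S" "\<And>u. g x z u = g x z' u"
  shows "z = z'"
proof -
  have "g x (z - z') (z - z') = 0"
    using assms by (simp add: bilinear_lsub[OF bilinear])
  with pos[OF assms(1), of "z - z'"] show ?thesis by force
qed

lemma smooth_on_metric:
  assumes "smooth_on S Y" "smooth_on S Z"
  shows "smooth_on S (\<lambda>x. g x (Y x) (Z x))"
proof (rule smooth_on_linear_family[OF open_img _ _ assms(1)])
  show "smooth_on S (\<lambda>y. g y v (Z y))" for v
    by (rule smooth_on_linear_family[OF open_img linear_right smooth assms(2)])
qed (rule linear_left)

text \<open>Gram-Schmidt on the standard basis, with the metric varying from point to point. The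
  span clause is carried along because \<open>b n\<close> lies outside the span of its predecessors;
  hence its orthogonal remainder \<open>w x\<close> vanishes nowhere and can be normalised
  smoothly.\<close>

lemma gram_schmidt:
  assumes b: "bij_betw b {..<DIM('e)} (Basis :: 'e set)" and "n \<le> DIM('e)"
  shows "\<exists>e. (\<forall>k<n. smooth_on S (e k)) \<and>
    (\<forall>x\<in>S. \<forall>k<n. \<forall>l<n. g x (e k x) (e l x) = (if k = l then 1 else 0)) \<and>
    (\<forall>x\<in>S. \<forall>k<n. e k x \<in> span (b ` {..<n}))"
  using assms(2)
proof (induction n)
  case 0
  then show ?case by simp
next
  case (Suc n)
  obtain e where e: "\<And>k. k < n \<Longrightarrow> smooth_on S (e k)"
    "\<And>x k l. x \<in> S \<Longrightarrow> k < n \<Longrightarrow> l < n \<Longrightarrow> g x (e k x) (e l x) = (if k = l then 1 else 0)"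
    "\<And>x k. x \<in> S \<Longrightarrow> k < n \<Longrightarrow> e k x \<in> span (b ` {..<n})"
    using Suc.IH[OF Suc_leD[OF Suc.prems]] by metis
  define w where "w x = b n - (\<Sum>k<n. g x (b n) (e k x) *\<^sub>R e k x)" for x
  define s where "s x = inverse (sqrt (g x (w x) (w x)))" for x
  have b_Basis: "b k \<in> Basis" if "k < DIM('e)" for k
    using b that by (auto simp: bij_betw_def)
  have notin: "b n \<notin> span (b ` {..<n})"
  proof
    assume "b n \<in> span (b ` {..<n})"
    moreover have "b ` {..<n} \<subseteq> Basis - {b n}"
      using b_Basis inj_on_eq_iff[OF bij_betw_imp_inj_on[OF b], of _ n] Suc.prems by auto
    ultimately have "b n \<in> span (Basis - {b n})"
      using span_mono by blast
    then show False
      using independent_Basis b_Basis[of n] Suc.prems by (auto simp: dependent_def)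
  qed
  have w_orth: "g x (w x) (e l x) = 0" if "x \<in> S" "l < n" for x l
  proof -
    have "g x (w x) (e l x) = g x (b n) (e l x)
        - (\<Sum>k<n. g x (b n) (e k x) * (if k = l then 1 else 0))"
      unfolding w_def using that
      by (simp add: bilinear_lsub[OF bilinear] linear_sum[OF linear_left] bilinear_lmul[OF bilinear] e(2))
    then show ?thesis using that by (simp add: if_distrib cong: if_cong)
  qed
  have w_pos: "g x (w x) (w x) > 0" if "x \<in> S" for x
  proof (rule pos[OF that])
    have "(\<Sum>k<n. g x (b n) (e k x) *\<^sub>R e k x) \<in> span (b ` {..<n})"
      by (intro span_sum span_scale) (use e(3) that in auto)
    with notin show "w x \<noteq> 0" by (auto simp: w_def)
  qed
  have s: "s x * (s x * g x (w x) (w x)) = 1" if "x \<in> S" for x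
    using w_pos[OF that] by (simp add: s_def field_simps)
  have "smooth_on S w"
    unfolding w_def
    by (intro smooth_on_diff smooth_on_sum smooth_on_scaleR smooth_on_metric smooth_on_const open_img e(1)) auto
  then have smooth': "smooth_on S (\<lambda>x. s x *\<^sub>R w x)"
    unfolding s_def
    by (intro smooth_on_scaleR smooth_on_inverse_sqrt smooth_on_metric open_img w_pos)
  have span: "s x *\<^sub>R w x \<in> span (b ` {..<Suc n})" if "x \<in> S" for x
    unfolding w_def
    by (intro span_scale span_diff span_sum)
      (use e(3)[OF that] span_mono[of "b ` {..<n}" "b ` {..<Suc n}"] in
        \<open>auto intro: span_base simp: lessThan_Suc\<close>)
  have span': "e k x \<in> span (b ` {..<Suc n})" if "x \<in> S" "k < n" for x k
    using e(3)[OF that] span_mono[of "b ` {..<n}" "b ` {..<Suc n}"] by (auto simp: lessThan_Suc)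
  have orth': "g x (e l x) (s x *\<^sub>R w x) = 0" "g x (s x *\<^sub>R w x) (e l x) = 0" if "x \<in> S" "l < n" for x l
    using w_orth[OF that] that(1) sym[OF that(1), of "e l x" "w x"]
    by (simp_all add: bilinear_lmul[OF bilinear] bilinear_rmul[OF bilinear])
  have unit': "g x (s x *\<^sub>R w x) (s x *\<^sub>R w x) = 1" if "x \<in> S" for x
    using s[OF that] that by (simp add: bilinear_lmul[OF bilinear] bilinear_rmul[OF bilinear])
  show ?case
    by (rule exI[of _ "e(n := \<lambda>x. s x *\<^sub>R w x)"])
      (auto simp: less_Suc_eq e(1,2) smooth' span span' orth' unit')
qed

lemma orthonormal_frame_exists: obtains e where "local_orthonormal_frame M i S e"
proof -
  obtain b where b: "bij_betw b {..<DIM('e)} (Basis :: 'e set)"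
    using ex_bij_betw_nat_finite[of "Basis :: 'e set"] by (auto simp: atLeast0LessThan)
  show ?thesis
    using gram_schmidt[OF b order.refl] that open_img by (auto simp: local_orthonormal_frame_def)
qed

text \<open>Orthonormal vectors are independent, and \<open>DIM('e)\<close> of them span. The
  remainder \<open>d\<close> is orthogonal to all of them, hence to itself, so it is zero.\<close>

lemma orthonormal_expansion:
  fixes e :: "nat \<Rightarrow> 'e"
  assumes x: "x \<in> S"
    and e: "\<And>k l. k < DIM('e) \<Longrightarrow> l < DIM('e) \<Longrightarrow> g x (e k) (e l) = (if k = l then 1 else 0)"
  shows "z = (\<Sum>k<DIM('e). g x z (e k) *\<^sub>R e k)"
proof -
  let ?E = "e ` {..<DIM('e)}"
  have inj: "inj_on e {..<DIM('e)}"
    by (rule inj_onI) (metis e lessThan_iff zero_neq_one)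
  have "independent ?E"
  proof (rule independent_if_scalars_zero)
    fix c v assume sum0: "(\<Sum>v\<in>?E. c v *\<^sub>R v) = 0" and "v \<in> ?E"
    then obtain l where l: "l < DIM('e)" "v = e l" by blast
    have "0 = g x (\<Sum>v\<in>?E. c v *\<^sub>R v) (e l)"
      using bilinear_lzero[OF bilinear[OF x]] by (simp add: sum0)
    also have "\<dots> = (\<Sum>k<DIM('e). c (e k) * g x (e k) (e l))"
      by (simp add: sum.reindex[OF inj] linear_sum[OF linear_left[OF x]] bilinear_lmul[OF bilinear[OF x]])
    also have "\<dots> = c v"
      using l by (simp add: e if_distrib cong: if_cong)
    finally show "c v = 0" by simp
  qed auto
  then have span: "span ?E = UNIV"
    using card_ge_dim_independent[of ?E UNIV] inj by (auto simp: card_image)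
  define d where "d = z - (\<Sum>k<DIM('e). g x z (e k) *\<^sub>R e k)"
  have "g x d (e l) = 0" if "l < DIM('e)" for l
  proof -
    have "g x d (e l) = g x z (e l) - (\<Sum>k<DIM('e). g x z (e k) * (if k = l then 1 else 0))"
      unfolding d_def using that x
      by (simp add: bilinear_lsub[OF bilinear] linear_sum[OF linear_left] bilinear_lmul[OF bilinear] e)
    then show ?thesis using that by (simp add: if_distrib cong: if_cong)
  qed
  then have "g x d v = 0" if "v \<in> span ?E" for v
    by (intro linear_eq_0_on_span[OF linear_right[OF x] _ that]) auto
  with span pos[OF x, of d] have "d = 0" by force
  then show ?thesis by (simp add: d_def)
qed

section \<open>The Koszul formula and the regularity of the Christoffel symbols\<close>

lemma linear_frechet_derivative_family:
  assumes "x \<in> S" "\<And>y. y \<in> S \<Longrightarrow> linear (A y)" "\<And>v. smooth_on S (\<lambda>y. A y v)"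
  shows "linear (\<lambda>v. frechet_derivative (\<lambda>y. A y v :: real) (at x) u)"
proof (rule linearI)
  note der = smooth_on_imp_has_derivative[OF assms(3,1)]
  fix v w c
  show "frechet_derivative (\<lambda>y. A y (v + w)) (at x) u =
      frechet_derivative (\<lambda>y. A y v) (at x) u + frechet_derivative (\<lambda>y. A y w) (at x) u"
    by (subst frechet_derivative_eqI[OF has_derivative_transform_within_open[OF
            has_derivative_add[OF der der] open_img assms(1)]])
      (simp_all add: linear_add[OF assms(2)])
  show "frechet_derivative (\<lambda>y. A y (c *\<^sub>R v)) (at x) u = c *\<^sub>R frechet_derivative (\<lambda>y. A y v) (at x) u"
    by (subst frechet_derivative_eqI[OF has_derivative_transform_within_open[OF
            has_derivative_scaleR_right[OF der] open_img assms(1)]])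
      (simp_all add: linear_cmul[OF assms(2)])
qed

lemmas linear_frechet_metric_left = linear_frechet_derivative_family[OF _ linear_left smooth]
lemmas linear_frechet_metric_right = linear_frechet_derivative_family[OF _ linear_right smooth]

text \<open>The right-hand side of the Koszul formula for constant fields, whose Lie brackets
  vanish. As a functional of \<open>u\<close> it can be shown linear and smooth before the vector
  representing it is constructed.\<close>

definition koszul :: "'e \<Rightarrow> 'e \<Rightarrow> 'e \<Rightarrow> 'e \<Rightarrow> real" where
  "koszul x v w u = frechet_derivative (\<lambda>y. g y w u) (at x) v
    + frechet_derivative (\<lambda>y. g y v u) (at x) w - frechet_derivative (\<lambda>y. g y v w) (at x) u"

lemma linear_koszul: "x \<in> S \<Longrightarrow> linear (koszul x v w)"
  unfolding koszul_def
  by (intro linear_compose_sub linear_compose_add linear_frechet_metric_right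
      linear_frechet_derivative_smooth_on[OF smooth])

lemma linear_koszul_left: "x \<in> S \<Longrightarrow> linear (\<lambda>v. koszul x v w u)"
  unfolding koszul_def
  by (intro linear_compose_sub linear_compose_add linear_frechet_metric_left
      linear_frechet_derivative_smooth_on[OF smooth])

lemma koszul_commute:
  assumes "x \<in> S"
  shows "koszul x v w u = koszul x w v u"
proof -
  have "frechet_derivative (\<lambda>y. g y v w) (at x) = frechet_derivative (\<lambda>y. g y w v) (at x)"
    by (rule frechet_derivative_transform_within_open[OF _ open_img assms])
      (use smooth_on_imp_differentiable[OF smooth assms] sym in auto)
  then show ?thesis by (simp add: koszul_def)
qed

lemma smooth_on_koszul: "smooth_on S (\<lambda>x. koszul x v w u)"
  unfolding koszul_def
  by (intro smooth_on_diff smooth_on_add smooth_on_frechet_derivative smooth open_img)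

text \<open>Riesz representation in an orthonormal basis: the coordinates of the representing vector
  are the values of the functional on the basis. This supplies the existence half for
  \<open>christoffel\<close>.\<close>

lemma koszul_eq_frame:
  fixes e :: "nat \<Rightarrow> 'e"
  assumes x: "x \<in> S"
    and e: "\<And>k l. k < DIM('e) \<Longrightarrow> l < DIM('e) \<Longrightarrow> g x (e k) (e l) = (if k = l then 1 else 0)"
  shows "2 * g x (\<Sum>k<DIM('e). (koszul x v w (e k) / 2) *\<^sub>R e k) u = koszul x v w u"
proof -
  have "koszul x v w u = koszul x v w (\<Sum>k<DIM('e). g x u (e k) *\<^sub>R e k)"
    using orthonormal_expansion[OF x e] by metis
  then show ?thesis
    by (simp add: linear_sum[OF linear_koszul[OF x]] linear_cmul[OF linear_koszul[OF x]]
        linear_sum[OF linear_left[OF x]] bilinear_lmul[OF bilinear[OF x]] sum_distrib_left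
        sym[OF x, of u] mult.commute)
qed

lemma christoffel_eq_frame:
  fixes e :: "nat \<Rightarrow> 'e"
  assumes x: "x \<in> S"
    and e: "\<And>k l. k < DIM('e) \<Longrightarrow> l < DIM('e) \<Longrightarrow> g x (e k) (e l) = (if k = l then 1 else 0)"
  shows "\<Gamma> x v w = (\<Sum>k<DIM('e). (koszul x v w (e k) / 2) *\<^sub>R e k)"
  using koszul_eq_frame[OF x e]
  by (intro christoffel_eqI[OF bilinear[OF x] pos[OF x]]) (simp_all add: koszul_def)

lemma orthonormal_basis_exists:
  assumes "x \<in> S"
  obtains e where
    "\<And>k l. k < DIM('e) \<Longrightarrow> l < DIM('e) \<Longrightarrow> g x (e k) (e l) = (if k = l then 1 else 0)"
proof -
  obtain e where e: "local_orthonormal_frame M i S e"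
    by (rule orthonormal_frame_exists)
  show ?thesis
    by (rule that[of "\<lambda>k. e k x"]) (use e assms in \<open>auto simp: local_orthonormal_frame_def\<close>)
qed

lemma christoffel_koszul:
  assumes "x \<in> S"
  shows "2 * g x (\<Gamma> x v w) u = koszul x v w u"
proof -
  obtain e where e:
    "\<And>k l. k < DIM('e) \<Longrightarrow> l < DIM('e) \<Longrightarrow> g x (e k) (e l) = (if k = l then 1 else 0)"
    using orthonormal_basis_exists[OF assms] by blast
  show ?thesis
    by (simp add: christoffel_eq_frame[OF assms e] koszul_eq_frame[OF assms e])
qed

text \<open>A smooth orthonormal frame turns \<open>christoffel_eq_frame\<close> into an explicit
  smooth formula, which avoids inverting the metric matrix.\<close>

lemma smooth_on_christoffel: "smooth_on S (\<lambda>x. \<Gamma> x v w)"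
proof -
  obtain e where e: "local_orthonormal_frame M i S e"
    by (rule orthonormal_frame_exists)
  show ?thesis
  proof (rule smooth_on_cong[OF open_img])
    show "smooth_on S (\<lambda>x. \<Sum>k<DIM('e). (1 / 2 * koszul x v w (e k x)) *\<^sub>R e k x)"
      using e unfolding local_orthonormal_frame_def
      by (intro smooth_on_sum smooth_on_scaleR smooth_on_mult smooth_on_const open_img
          smooth_on_linear_family[OF open_img linear_koszul smooth_on_koszul]) auto
    show "(\<Sum>k<DIM('e). (1 / 2 * koszul x v w (e k x)) *\<^sub>R e k x) = \<Gamma> x v w" if "x \<in> S" for x
      using e that by (subst christoffel_eq_frame[OF that, of "\<lambda>k. e k x"])
        (auto simp: local_orthonormal_frame_def)
  qed
qed

lemma linear_christoffel_left:
  assumes x: "x \<in> S"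
  shows "linear (\<lambda>v. \<Gamma> x v w)"
proof (rule linearI)
  show "\<Gamma> x (v + v') w = \<Gamma> x v w + \<Gamma> x v' w" for v v'
  proof (rule metric_eqI[OF x])
    show "g x (\<Gamma> x (v + v') w) u = g x (\<Gamma> x v w + \<Gamma> x v' w) u" for u
      using christoffel_koszul[OF x, of "v + v'" w u] christoffel_koszul[OF x, of v w u]
        christoffel_koszul[OF x, of v' w u] linear_add[OF linear_koszul_left[OF x], of v v' w u]
      unfolding bilinear_ladd[OF bilinear[OF x]] by linarith
  qed
  show "\<Gamma> x (k *\<^sub>R v) w = k *\<^sub>R \<Gamma> x v w" for k v
  proof (rule metric_eqI[OF x])
    show "g x (\<Gamma> x (k *\<^sub>R v) w) u = g x (k *\<^sub>R \<Gamma> x v w) u" for u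
      using christoffel_koszul[OF x, of "k *\<^sub>R v" w u] christoffel_koszul[OF x, of v w u, symmetric]
        linear_cmul[OF linear_koszul_left[OF x], of k v w u]
      by (simp add: bilinear_lmul[OF bilinear[OF x]])
  qed
qed

lemma christoffel_commute:
  assumes "x \<in> S"
  shows "\<Gamma> x v w = \<Gamma> x w v"
  using koszul_commute[OF assms, of v w] unfolding christoffel_def koszul_def[symmetric] by simp

lemma linear_christoffel_right: "x \<in> S \<Longrightarrow> linear (\<Gamma> x v)"
  using linear_christoffel_left[of x v] christoffel_commute[of x v] by (metis (lifting) ext)

text \<open>Base point and both arguments move together, as in the connection term along an
  immersion. The Leibniz rule for linear families is applied first in the slot of \<open>Y\<close>,
  with the other argument fixed, and then in the slot of \<open>X\<close>.\<close>

lemma has_derivative_christoffel_along: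
  fixes r :: "'a::real_normed_vector \<Rightarrow> 'e"
  assumes U: "open U" "z \<in> U" "r ` U \<subseteq> S"
    and r: "(r has_derivative r') (at z)"
    and X: "(X has_derivative X') (at z)" and Y: "(Y has_derivative Y') (at z)"
  shows "((\<lambda>z. \<Gamma> (r z) (X z) (Y z)) has_derivative
    (\<lambda>u. frechet_derivative (\<lambda>y. \<Gamma> y (X z) (Y z)) (at (r z)) (r' u)
      + \<Gamma> (r z) (X' u) (Y z) + \<Gamma> (r z) (X z) (Y' u))) (at z)"
proof -
  have in_S: "r y \<in> S" if "y \<in> U" for y
    using that U by auto
  have base: "((\<lambda>z. \<Gamma> (r z) v w) has_derivative
      (\<lambda>u. frechet_derivative (\<lambda>y. \<Gamma> y v w) (at (r z)) (r' u))) (at z)" for v w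
    by (rule has_derivative_compose[OF r])
      (rule smooth_on_imp_has_derivative[OF smooth_on_christoffel in_S[OF U(2)]])
  have right: "((\<lambda>z. \<Gamma> (r z) v (Y z)) has_derivative
      (\<lambda>u. frechet_derivative (\<lambda>y. \<Gamma> y v (Y z)) (at (r z)) (r' u) + \<Gamma> (r z) v (Y' u))) (at z)" for v
    using has_derivative_linear_family[where A = "\<lambda>z. \<Gamma> (r z) v",
        OF U(1,2) linear_christoffel_right[OF in_S] _ Y]
    by (simp add: frechet_derivative_eqI[OF base] differentiableI[OF base])
  have "((\<lambda>y. \<Gamma> (r y) (X y) (Y y)) has_derivative
      (\<lambda>u. frechet_derivative (\<lambda>y. \<Gamma> (r y) (X z) (Y y)) (at z) u + \<Gamma> (r z) (X' u) (Y z))) (at z)"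
    by (rule has_derivative_linear_family[OF U(1,2) linear_christoffel_left[OF in_S] _ X])
      (auto intro: differentiableI[OF right])
  then show ?thesis
    by (simp add: frechet_derivative_eqI[OF right] add_ac)
qed

lemma levi_civita_const: "levi_civita M i (\<lambda>_. v) (\<lambda>_. w) = (\<lambda>x. \<Gamma> x v w)"
  by (simp add: levi_civita_def along_def fun_eq_iff)

text \<open>Constant fields commute, so the bracket term is a Christoffel symbol with a zero
  argument; the other two terms are derivatives of \<open>\<Gamma>\<close> plus its
  products.\<close>

lemma curvature_const:
  assumes "x \<in> S"
  shows "curvature M i (\<lambda>_. u) (\<lambda>_. v) (\<lambda>_. w) x =
    frechet_derivative (\<lambda>y. \<Gamma> y v w) (at x) u + \<Gamma> x u (\<Gamma> x v w)
    - (frechet_derivative (\<lambda>y. \<Gamma> y u w) (at x) v + \<Gamma> x v (\<Gamma> x u w))"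
  using linear_0[OF linear_christoffel_left[OF assms], of w]
  unfolding curvature_def levi_civita_const
  by (simp add: levi_civita_def along_def lie_bracket_def)

end

lemma riemannian_chartI:
  assumes "riemannian_manifold M" "i \<in> charts M"
  shows "riemannian_chart M i"
  using assms unfolding riemannian_manifold_def smooth_atlas_def
  by unfold_locales blast+

subsection \<open>Charts of warped products\<close>

lemma warped_product_simps:
  "charts (warped_product B f F) = charts B \<times> charts F"
  "chart_dom (warped_product B f F) (i, j) = chart_dom B i \<times> chart_dom F j"
  "chart_map (warped_product B f F) (i, j) = map_prod (chart_map B i) (chart_map F j)"
  "chart_metric (warped_product B f F) (i, j) (x, y) (v, v') (w, w') =
    chart_metric B i x v w + (f (chart_inv B i x))\<^sup>2 * chart_metric F j y v' w'"
  by (simp_all add: warped_product_def)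

lemma chart_img_warped_product:
  "chart_img (warped_product B f F) (i, j) = chart_img B i \<times> chart_img F j"
  by (auto simp: chart_img_def warped_product_simps image_iff)

text \<open>The inverse chart is an \<open>inv_into\<close>, which is known to be the product of the
  two inverse charts only on the chart image; hence the detour through
  \<open>homeomorphism_cong\<close>.\<close>

lemma homeomorphism_chart_warped_product:
  assumes "homeomorphism (chart_dom B i) (chart_img B i) (chart_map B i) (chart_inv B i)"
    and "homeomorphism (chart_dom F j) (chart_img F j) (chart_map F j) (chart_inv F j)"
    and W: "W = warped_product B f F"
  shows "homeomorphism (chart_dom W (i, j)) (chart_img W (i, j)) (chart_map W (i, j)) (chart_inv W (i, j))"
proof (rule homeomorphism_cong)
  let ?inv = "map_prod (chart_inv B i) (chart_inv F j)"
  have B: "chart_inv B i (chart_map B i b) = b" if "b \<in> chart_dom B i" for b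
    using assms(1) that by (auto simp: homeomorphism_def)
  have F: "chart_inv F j (chart_map F j b) = b" if "b \<in> chart_dom F j" for b
    using assms(2) that by (auto simp: homeomorphism_def)
  have inj: "inj_on (chart_map W (i, j)) (chart_dom W (i, j))"
    unfolding W warped_product_simps
    by (intro map_prod_inj_on inj_on_inverseI[of _ "chart_inv B i"]
        inj_on_inverseI[of _ "chart_inv F j"]) (use B F in auto)
  show "chart_inv W (i, j) z = ?inv z" if "z \<in> chart_img W (i, j)" for z
    using that unfolding chart_img_def chart_inv_def[of W]
    by (auto simp: inv_into_f_f[OF inj]) (auto simp: W warped_product_simps B F)
  have cont: "continuous_on (S \<times> T) (map_prod h k)"
    if "continuous_on S h" "continuous_on T k" for S T
      and h :: "'x::topological_space \<Rightarrow> 'y::topological_space"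
      and k :: "'z::topological_space \<Rightarrow> 'w::topological_space"
    unfolding map_prod_def case_prod_unfold
    by (intro continuous_on_Pair continuous_on_compose2[OF that(1)] continuous_on_compose2[OF that(2)]
        continuous_on_fst continuous_on_snd continuous_on_id) auto
  show "homeomorphism (chart_dom W (i, j)) (chart_img W (i, j)) (chart_map W (i, j)) ?inv"
    using assms(1,2) unfolding W chart_img_warped_product warped_product_simps homeomorphism_def
    by (auto intro!: cont simp: map_prod_surj_on)
qed simp_all

text \<open>The preimage under the continuous \<open>\<psi>\<close> is open in the chart domain, and
  the chart is a homeomorphism onto an open set, hence an open map.\<close>

lemma open_local_dom:
  assumes "homeomorphism (chart_dom M i) (chart_img M i) (chart_map M i) (chart_inv M i)"
    and "open (chart_dom M i)" "open (chart_img M i)" "i \<in> charts M"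
    and "continuous_on (carrier M) \<psi>" "open (chart_dom N j)"
  shows "open (local_dom M N \<psi> i j)"
proof -
  have "continuous_on (chart_dom M i) \<psi>"
    using assms(4,5) by (auto simp: carrier_def intro: continuous_on_subset)
  then have "open (chart_dom M i \<inter> \<psi> -` chart_dom N j)"
    using assms(2,6) by (simp add: continuous_on_open_vimage Int_commute)
  then have "openin (top_of_set (chart_dom M i)) (chart_dom M i \<inter> \<psi> -` chart_dom N j)"
    by (simp add: assms(2) openin_open_eq)
  then have "openin (top_of_set (chart_img M i)) (local_dom M N \<psi> i j)"
    unfolding local_dom_def by (rule homeomorphism_imp_open_map[OF assms(1)])
  then show ?thesis
    using assms(3) openin_open_trans by blast
qed

locale warped_chart = B: riemannian_chart B i + F: riemannian_chart F j
  for B :: "('i, 'b, 'eb::euclidean_space) rmanifold" and i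
    and F :: "('j, 'f, 'ef::euclidean_space) rmanifold" and j +
  fixes f :: "'b \<Rightarrow> real"
  assumes smooth_warping: "smooth_on (chart_img B i) (f \<circ> chart_inv B i)"
    and warping_pos: "x \<in> chart_img B i \<Longrightarrow> f (chart_inv B i x) > 0"
begin

abbreviation h where "h x \<equiv> f (chart_inv B i x)"
abbreviation Dh where "Dh x \<equiv> frechet_derivative (\<lambda>x. f (chart_inv B i x)) (at x)"
abbreviation W where "W \<equiv> warped_product B f F"

lemma smooth_on_h: "smooth_on B.S h"
  using smooth_warping by (simp add: comp_def)

lemma has_derivative_warped_metric:
  assumes "x \<in> B.S" "y \<in> F.S"
  shows "((\<lambda>z. chart_metric W (i, j) z (v, v') (w, w')) has_derivative
    (\<lambda>u. frechet_derivative (\<lambda>x. B.g x v w) (at x) (fst u)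
      + 2 * h x * Dh x (fst u) * F.g y v' w'
      + (h x)\<^sup>2 * frechet_derivative (\<lambda>y. F.g y v' w') (at y) (snd u))) (at (x, y))"
proof -
  have eq: "(\<lambda>z. chart_metric W (i, j) z (v, v') (w, w')) =
      (\<lambda>z. B.g (fst z) v w + (h (fst z))\<^sup>2 * F.g (snd z) v' w')"
    by (auto simp: warped_product_simps)
  have fst: "((\<lambda>z. k (fst z)) has_derivative (\<lambda>u. frechet_derivative k (at x) (fst u))) (at (x, y))"
    if "smooth_on B.S k" for k :: "'eb \<Rightarrow> real"
    by (rule has_derivative_compose[of fst])
      (use smooth_on_imp_has_derivative[OF that assms(1)] in \<open>auto intro!: derivative_eq_intros\<close>)
  have snd: "((\<lambda>z. k (snd z)) has_derivative (\<lambda>u. frechet_derivative k (at y) (snd u))) (at (x, y))"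
    if "smooth_on F.S k" for k :: "'ef \<Rightarrow> real"
    by (rule has_derivative_compose[of snd])
      (use smooth_on_imp_has_derivative[OF that assms(2)] in \<open>auto intro!: derivative_eq_intros\<close>)
  show ?thesis
    unfolding eq
    by (rule has_derivative_eq_rhs, rule has_derivative_add[OF fst[OF B.smooth]
        has_derivative_mult[OF has_derivative_power[OF fst[OF smooth_on_h]] snd[OF F.smooth]]])
      (auto simp: algebra_simps)
qed

lemma bilinear_warped:
  assumes "x \<in> B.S" "y \<in> F.S"
  shows "bilinear (chart_metric W (i, j) (x, y))"
  unfolding bilinear_def
  using B.bilinear[OF assms(1)] F.bilinear[OF assms(2)]
  by (auto intro!: linearI simp: warped_product_simps bilinear_ladd bilinear_radd bilinear_lmul
      bilinear_rmul algebra_simps)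

lemma warped_pos:
  assumes "x \<in> B.S" "y \<in> F.S" "v \<noteq> 0"
  shows "chart_metric W (i, j) (x, y) v v > 0"
proof (cases v)
  case (Pair a b)
  have "B.g x a a \<ge> 0" "a \<noteq> 0 \<Longrightarrow> B.g x a a > 0"
    using B.pos[OF assms(1), of a] bilinear_lzero[OF B.bilinear[OF assms(1)]] by (cases "a = 0"; force)+
  moreover have "F.g y b b \<ge> 0" "b \<noteq> 0 \<Longrightarrow> F.g y b b > 0"
    using F.pos[OF assms(2), of b] bilinear_lzero[OF F.bilinear[OF assms(2)]] by (cases "b = 0"; force)+
  ultimately show ?thesis
    using assms(3) warping_pos[OF assms(1)] Pair
    by (cases "a = 0") (auto simp: warped_product_simps zero_prod_def intro: add_nonneg_pos add_pos_nonneg)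
qed

text \<open>With both arguments horizontal, the fibre part of every metric term has a zero argument.
  The Koszul formula of the base, tested on the horizontal part of \<open>u\<close>,
  remains.\<close>

lemma christoffel_warped_horizontal:
  assumes "x \<in> B.S" "y \<in> F.S"
  shows "christoffel W (i, j) (x, y) (v, 0) (w, 0) = (B.\<Gamma> x v w, 0)"
proof (rule christoffel_eqI[OF bilinear_warped warped_pos], goal_cases)
  \<comment> \<open>The first five goals are the side conditions of \<open>bilinear_warped\<close>
    and \<open>warped_pos\<close>; the sixth is the Koszul identity.\<close>
  case (6 u)
  show ?case
    using B.christoffel_koszul[OF assms(1), of v w "fst u"] bilinear_lzero[OF F.bilinear[OF assms(2)]]
      linear_0[OF F.linear_frechet_metric_left[OF assms(2)]]
      linear_0[OF linear_frechet_derivative_smooth_on[OF F.smooth assms(2)]]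
    by (cases u) (simp add: frechet_derivative_eqI[OF has_derivative_warped_metric[OF assms]]
        warped_product_simps B.koszul_def)
qed (use assms in auto)

text \<open>Only the derivative of the squared warping function along \<open>a\<close> survives in
  the Koszul expression, namely \<open>2 * h x * Dh x a\<close> times the fibre product of
  \<open>v\<close> and \<open>snd u\<close>. Division by twice the square of \<open>h x\<close>
  gives the logarithmic derivative.\<close>

lemma christoffel_warped_mixed:
  assumes "x \<in> B.S" "y \<in> F.S"
  shows "christoffel W (i, j) (x, y) (0, v) (a, 0) = (0, (Dh x a / h x) *\<^sub>R v)"
    and "christoffel W (i, j) (x, y) (a, 0) (0, v) = (0, (Dh x a / h x) *\<^sub>R v)"
proof -
  note zeros = bilinear_lzero[OF F.bilinear[OF assms(2)]] bilinear_rzero[OF F.bilinear[OF assms(2)]]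
    bilinear_lzero[OF B.bilinear[OF assms(1)]] bilinear_rzero[OF B.bilinear[OF assms(1)]]
    linear_0[OF F.linear_frechet_metric_left[OF assms(2)]]
    linear_0[OF F.linear_frechet_metric_right[OF assms(2)]]
    linear_0[OF B.linear_frechet_metric_left[OF assms(1)]]
    linear_0[OF B.linear_frechet_metric_right[OF assms(1)]]
    linear_0[OF linear_frechet_derivative_smooth_on[OF F.smooth assms(2)]]
    linear_0[OF linear_frechet_derivative_smooth_on[OF B.smooth assms(1)]]
    linear_0[OF linear_frechet_derivative_smooth_on[OF smooth_on_h assms(1)]]
  note simps = zeros frechet_derivative_eqI[OF has_derivative_warped_metric[OF assms]]
    warped_product_simps bilinear_lmul[OF F.bilinear[OF assms(2)]] power2_eq_square
  show "christoffel W (i, j) (x, y) (0, v) (a, 0) = (0, (Dh x a / h x) *\<^sub>R v)"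
  proof (rule christoffel_eqI[OF bilinear_warped warped_pos], goal_cases)
    case (6 u)
    show ?case
      using warping_pos[OF assms(1)] by (cases u) (simp add: simps)
  qed (use assms in auto)
  show "christoffel W (i, j) (x, y) (a, 0) (0, v) = (0, (Dh x a / h x) *\<^sub>R v)"
  proof (rule christoffel_eqI[OF bilinear_warped warped_pos], goal_cases)
    case (6 u)
    show ?case
      using warping_pos[OF assms(1)] by (cases u) (simp add: simps)
  qed (use assms in auto)
qed

end

subsection \<open>The Hessian of the warping function\<close>

text \<open>The left side of the conclusion is minus the Hessian of \<open>h\<close> on
  \<open>(a, a)\<close>. The equation \<open>tg\<close> is the vanishing of the second fundamental
  form on constant fields; it is assumed throughout \<open>U\<close> because it gets differentiated
  once more.\<close>

lemma (in warped_chart) hessian_warping: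
  fixes r :: "'eb \<times> 'ef \<Rightarrow> 'en::euclidean_space"
    and N :: "('l, 'n, 'en) rmanifold"
  assumes "riemannian_chart N l"
    and U: "open U" "(x, y) \<in> U" "U \<subseteq> B.S \<times> F.S"
    and r: "smooth_on U r" "r ` U \<subseteq> chart_img N l"
    and iso: "\<And>v w. chart_metric N l (r (x, y)) (frechet_derivative r (at (x, y)) v)
        (frechet_derivative r (at (x, y)) w) = chart_metric W (i, j) (x, y) v w"
    and tg: "\<And>z v w. z \<in> U \<Longrightarrow> frechet_derivative (\<lambda>z. frechet_derivative r (at z) w) (at z) v =
        frechet_derivative r (at z) (christoffel W (i, j) z v w)
        - christoffel N l (r z) (frechet_derivative r (at z) v) (frechet_derivative r (at z) w)"
    and sec: "\<And>v w. v \<noteq> w \<Longrightarrow> independent {v, w} \<Longrightarrow> sectional_curvature N l (r (x, y)) v w = c"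
  shows "Dh x (B.\<Gamma> x a a) - frechet_derivative (\<lambda>x. Dh x a) (at x) a = c * h x * B.g x a a"
proof (cases "a = 0")
  case True
  have x: "x \<in> B.S" using U by auto
  show ?thesis
    using True linear_0[OF linear_frechet_derivative_smooth_on[OF smooth_on_h x]]
      linear_0[OF linear_frechet_derivative_smooth_on[OF
          smooth_on_frechet_derivative[OF smooth_on_h] x]]
      linear_0[OF B.linear_christoffel_left[OF x]] bilinear_lzero[OF B.bilinear[OF x]]
    by simp
next
  case False
  interpret N: riemannian_chart N l by fact
  have xy: "x \<in> B.S" "y \<in> F.S" using U by auto
  have in_U: "fst z \<in> B.S" "snd z \<in> F.S" if "z \<in> U" for z
    using U(3) that by auto
  \<comment> \<open>The fibre has positive dimension, so it provides a nonzero vertical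
    vector.\<close>
  obtain b :: 'ef where "b \<in> Basis" using nonempty_Basis by blast
  then have "b \<noteq> 0" by auto
  define v where "v = (a, 0 :: 'ef)"
  define w where "w = (0 :: 'eb, b)"
  define D where "D z = frechet_derivative r (at z)" for z
  define G where "G z = N.\<Gamma> (r z)" for z
  \<comment> \<open>The coefficient from \<open>christoffel_warped_mixed\<close>: the derivative of
    the logarithm of \<open>h\<close> along \<open>a\<close>.\<close>
  define k where "k x = Dh x a / h x" for x
  define k' where "k' = frechet_derivative k (at x) a"
  define z where "z = (x, y)"
  define \<alpha> where "\<alpha> = D z v"
  define \<beta> where "\<beta> = D z w"
  define p where "p = B.\<Gamma> x a a"
  have z: "z \<in> U" "r z \<in> N.S" using U r by (auto simp: z_def)
  have linD: "linear (D q)" if "q \<in> U" for q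
    unfolding D_def by (rule linear_frechet_derivative_smooth_on[OF r(1) that])
  have smoothD: "smooth_on U (\<lambda>q. D q u)" for u
    unfolding D_def by (rule smooth_on_frechet_derivative[OF r(1)])
  note derD = smooth_on_imp_has_derivative[OF smoothD z(1)]
  have derr: "(r has_derivative D z) (at z)"
    unfolding D_def by (rule smooth_on_imp_has_derivative[OF r(1) z(1)])
  \<comment> \<open>The equation \<open>tg\<close> for the needed pairs of directions. The
    horizontal vector in \<open>wu\<close> is left general because it is used for \<open>a\<close>
    and for the base Christoffel vector \<open>p\<close>.\<close>
  have vv: "frechet_derivative (\<lambda>q. D q v) (at q) v =
      D q (B.\<Gamma> (fst q) a a, 0) - G q (D q v) (D q v)"
    and wu: "frechet_derivative (\<lambda>q. D q (u, 0)) (at q) w =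
      (Dh (fst q) u / h (fst q)) *\<^sub>R D q w - G q (D q w) (D q (u, 0))"
    and vw: "frechet_derivative (\<lambda>q. D q w) (at q) v = k (fst q) *\<^sub>R D q w - G q (D q v) (D q w)"
    if "q \<in> U" for q u
    using tg[OF that, of v v] tg[OF that, of "(u, 0)" w] tg[OF that, of w v] in_U[OF that]
      christoffel_warped_horizontal[OF in_U[OF that], of a a]
      christoffel_warped_mixed[OF in_U[OF that]] linear_cmul[OF linD[OF that], of _ w]
    by (simp_all add: D_def G_def v_def w_def k_def)

  have derk: "(k has_derivative (\<lambda>u. (frechet_derivative (\<lambda>x. Dh x a) (at x) u * h x - Dh x a * Dh x u)
      / (h x * h x))) (at x)"
    unfolding k_def
    using warping_pos[OF xy(1)]
    by (auto intro!: derivative_eq_intros smooth_on_imp_has_derivative[OF smooth_on_h xy(1)]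
        smooth_on_imp_has_derivative[OF smooth_on_frechet_derivative[OF smooth_on_h] xy(1)]
        simp: field_simps)
  have derkfst: "((\<lambda>q. k (fst q)) has_derivative (\<lambda>u. frechet_derivative k (at x) (fst u))) (at z)"
    unfolding z_def
    by (rule has_derivative_compose[of fst])
      (use derk in \<open>auto intro!: derivative_eq_intros simp: frechet_derivative_eqI[OF derk]\<close>)
  have der\<Gamma>: "((\<lambda>q. (B.\<Gamma> (fst q) a a, 0 :: 'ef)) has_derivative
      (\<lambda>u. (frechet_derivative (\<lambda>x. B.\<Gamma> x a a) (at x) (fst u), 0))) (at z)"
    unfolding z_def
    by (intro has_derivative_Pair has_derivative_const, rule has_derivative_compose[of fst])
      (use smooth_on_imp_has_derivative[OF B.smooth_on_christoffel xy(1)] in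
        \<open>auto intro!: derivative_eq_intros\<close>)
  have derP: "((\<lambda>q. D q (B.\<Gamma> (fst q) a a, 0)) has_derivative
      (\<lambda>u. frechet_derivative (\<lambda>q. D q (p, 0)) (at z) u
        + D z (frechet_derivative (\<lambda>x. B.\<Gamma> x a a) (at x) (fst u), 0))) (at z)"
    using has_derivative_linear_family[where A = D, OF U(1) z(1) linD _ der\<Gamma>]
      smooth_on_imp_differentiable[OF smoothD z(1)] by (simp add: p_def z_def)
  have derG: "((\<lambda>q. G q (D q s) (D q t)) has_derivative
      (\<lambda>u. frechet_derivative (\<lambda>y. N.\<Gamma> y (D z s) (D z t)) (at (r z)) (D z u)
        + G z (frechet_derivative (\<lambda>q. D q s) (at z) u) (D z t)
        + G z (D z s) (frechet_derivative (\<lambda>q. D q t) (at z) u))) (at z)" for s t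
    unfolding G_def
    by (rule N.has_derivative_christoffel_along[OF U(1) z(1) r(2) derr derD derD])

  \<comment> \<open>First order of differentiation: \<open>vv\<close> is differentiated along the
    vertical \<open>w\<close>.\<close>
  have "frechet_derivative (\<lambda>q. frechet_derivative (\<lambda>q. D q v) (at q) v) (at z) =
      frechet_derivative (\<lambda>q. D q (B.\<Gamma> (fst q) a a, 0) - G q (D q v) (D q v)) (at z)"
    by (rule frechet_derivative_transform_within_open[OF
          smooth_on_imp_differentiable[OF smooth_on_frechet_derivative[OF smoothD] z(1)] U(1) z(1) vv])
  also have "\<dots> = (\<lambda>u. frechet_derivative (\<lambda>q. D q (p, 0)) (at z) u
      + D z (frechet_derivative (\<lambda>x. B.\<Gamma> x a a) (at x) (fst u), 0)
      - (frechet_derivative (\<lambda>y. N.\<Gamma> y \<alpha> \<alpha>) (at (r z)) (D z u)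
        + G z (frechet_derivative (\<lambda>q. D q v) (at z) u) \<alpha>
        + G z \<alpha> (frechet_derivative (\<lambda>q. D q v) (at z) u)))"
    unfolding \<alpha>_def by (rule frechet_derivative_eqI[OF has_derivative_diff[OF derP derG]])
  finally have "frechet_derivative (\<lambda>q. frechet_derivative (\<lambda>q. D q v) (at q) v) (at z) w =
      frechet_derivative (\<lambda>q. D q (p, 0)) (at z) w
      + D z (frechet_derivative (\<lambda>x. B.\<Gamma> x a a) (at x) 0, 0)
      - (frechet_derivative (\<lambda>y. N.\<Gamma> y \<alpha> \<alpha>) (at (r z)) \<beta>
        + G z (frechet_derivative (\<lambda>q. D q v) (at z) w) \<alpha>
        + G z \<alpha> (frechet_derivative (\<lambda>q. D q v) (at z) w))"
    by (simp add: w_def \<beta>_def)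
  \<comment> \<open>The vector \<open>w\<close> has no horizontal component, so the base Christoffel
    symbols do not change along it.\<close>
  also have "D z (frechet_derivative (\<lambda>x. B.\<Gamma> x a a) (at x) 0, 0) = 0"
    using linear_0[OF linear_frechet_derivative_smooth_on[OF B.smooth_on_christoffel xy(1)]]
      linear_0[OF linD[OF z(1)]] by (simp add: zero_prod_def)
  finally have lhs: "frechet_derivative (\<lambda>q. frechet_derivative (\<lambda>q. D q v) (at q) v) (at z) w =
      (Dh x p / h x) *\<^sub>R \<beta> - G z \<beta> (D z (p, 0))
      - (frechet_derivative (\<lambda>y. N.\<Gamma> y \<alpha> \<alpha>) (at (r z)) \<beta>
        + G z (k x *\<^sub>R \<beta> - G z \<beta> \<alpha>) \<alpha> + G z \<alpha> (k x *\<^sub>R \<beta> - G z \<beta> \<alpha>))"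
    using wu[OF z(1), of p] wu[OF z(1), of a]
    by (simp add: z_def k_def \<beta>_def \<alpha>_def flip: v_def)

  \<comment> \<open>Second order of differentiation: \<open>wu\<close> for \<open>a\<close> is
    differentiated along the horizontal \<open>v\<close>.\<close>
  have "frechet_derivative (\<lambda>q. frechet_derivative (\<lambda>q. D q v) (at q) w) (at z) =
      frechet_derivative (\<lambda>q. k (fst q) *\<^sub>R D q w - G q (D q w) (D q v)) (at z)"
    by (rule frechet_derivative_transform_within_open[OF
          smooth_on_imp_differentiable[OF smooth_on_frechet_derivative[OF smoothD] z(1)] U(1) z(1)])
      (use wu[of _ a] in \<open>simp add: k_def v_def\<close>)
  also have "\<dots> = (\<lambda>u. k x *\<^sub>R frechet_derivative (\<lambda>q. D q w) (at z) u
      + frechet_derivative k (at x) (fst u) *\<^sub>R \<beta>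
      - (frechet_derivative (\<lambda>y. N.\<Gamma> y \<beta> \<alpha>) (at (r z)) (D z u)
        + G z (frechet_derivative (\<lambda>q. D q w) (at z) u) \<alpha>
        + G z \<beta> (frechet_derivative (\<lambda>q. D q v) (at z) u)))"
    using has_derivative_diff[OF has_derivative_scaleR[OF derkfst derD[of w]] derG[of w v]]
    unfolding \<alpha>_def \<beta>_def by (intro frechet_derivative_eqI) (simp add: z_def)
  finally have "frechet_derivative (\<lambda>q. frechet_derivative (\<lambda>q. D q v) (at q) w) (at z) v =
      k x *\<^sub>R frechet_derivative (\<lambda>q. D q w) (at z) v + k' *\<^sub>R \<beta>
      - (frechet_derivative (\<lambda>y. N.\<Gamma> y \<beta> \<alpha>) (at (r z)) \<alpha>
        + G z (frechet_derivative (\<lambda>q. D q w) (at z) v) \<alpha>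
        + G z \<beta> (frechet_derivative (\<lambda>q. D q v) (at z) v))"
    by (simp add: v_def \<alpha>_def k'_def)
  then have rhs: "frechet_derivative (\<lambda>q. frechet_derivative (\<lambda>q. D q v) (at q) w) (at z) v =
      k x *\<^sub>R (k x *\<^sub>R \<beta> - G z \<alpha> \<beta>) + k' *\<^sub>R \<beta>
      - (frechet_derivative (\<lambda>y. N.\<Gamma> y \<beta> \<alpha>) (at (r z)) \<alpha>
        + G z (k x *\<^sub>R \<beta> - G z \<alpha> \<beta>) \<alpha> + G z \<beta> (D z (p, 0) - G z \<alpha> \<alpha>))"
    using vw[OF z(1)] vv[OF z(1)] by (simp add: z_def p_def \<beta>_def \<alpha>_def)

  define R where "R = frechet_derivative (\<lambda>y. N.\<Gamma> y \<alpha> \<alpha>) (at (r z)) \<beta> + G z \<beta> (G z \<alpha> \<alpha>)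
    - (frechet_derivative (\<lambda>y. N.\<Gamma> y \<beta> \<alpha>) (at (r z)) \<alpha> + G z \<alpha> (G z \<beta> \<alpha>))"
  have R: "curvature N l (\<lambda>_. \<beta>) (\<lambda>_. \<alpha>) (\<lambda>_. \<alpha>) (r z) = R"
    unfolding N.curvature_const[OF z(2)] R_def G_def ..
  have linG: "linear (\<lambda>u. G z u q)" "linear (G z q)" for q
    unfolding G_def by (rule N.linear_christoffel_left[OF z(2)] N.linear_christoffel_right[OF z(2)])+
  have symG: "G z \<alpha> q = G z q \<alpha>" for q
    unfolding G_def by (rule N.christoffel_commute[OF z(2)])
  \<comment> \<open>Equating \<open>lhs\<close> and \<open>rhs\<close>, the terms with
    \<open>D z (p, 0)\<close> and those in which \<open>k x\<close> multiplies a Christoffel symbol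
    cancel. The remaining Christoffel terms are exactly \<open>R\<close>.\<close>
  have "R = (Dh x p / h x - k' - k x * k x) *\<^sub>R \<beta>"
    using second_derivative_symmetric[OF U(1) z(1) smoothD[of v], of v w]
    unfolding lhs rhs R_def
    by (simp add: linear_diff[OF linG(1)] linear_diff[OF linG(2)] linear_cmul[OF linG(1)]
        linear_cmul[OF linG(2)] symG[of \<beta>] symG[of "G z \<beta> \<alpha>"] algebra_simps)
  \<comment> \<open>Since \<open>k\<close> is a logarithmic derivative,
    \<open>k' + k x * k x\<close> is the second derivative of \<open>h\<close> along
    \<open>a\<close> divided by \<open>h x\<close>.\<close>
  also have "Dh x p / h x - k' - k x * k x =
      (Dh x p - frechet_derivative (\<lambda>x. Dh x a) (at x) a) / h x"
    using warping_pos[OF xy(1)]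
    by (simp add: k'_def frechet_derivative_eqI[OF derk] k_def field_simps)
  finally have R_eq: "R = ((Dh x p - frechet_derivative (\<lambda>x. Dh x a) (at x) a) / h x) *\<^sub>R \<beta>" .

  have metric: "N.g (r z) \<alpha> \<alpha> = B.g x a a" "N.g (r z) \<beta> \<alpha> = 0"
    "N.g (r z) \<beta> \<beta> = (h x)\<^sup>2 * F.g y b b"
    using iso[of v v] iso[of w v] iso[of w w]
      bilinear_lzero[OF B.bilinear[OF xy(1)]] bilinear_rzero[OF B.bilinear[OF xy(1)]]
      bilinear_lzero[OF F.bilinear[OF xy(2)]] bilinear_rzero[OF F.bilinear[OF xy(2)]]
    by (simp_all add: \<alpha>_def \<beta>_def D_def z_def v_def w_def warped_product_simps)
  have pos: "N.g (r z) \<alpha> \<alpha> > 0" "N.g (r z) \<beta> \<beta> > 0"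
    using metric B.pos[OF xy(1) False] F.pos[OF xy(2) \<open>b \<noteq> 0\<close>] warping_pos[OF xy(1)] by auto
  \<comment> \<open>The image vectors are orthogonal and nonzero, hence span a plane to which
    \<open>sec\<close> applies; orthogonality also removes the mixed term from the denominator of
    the sectional curvature.\<close>
  have notin: "\<beta> \<notin> span {\<alpha>}"
  proof
    assume "\<beta> \<in> span {\<alpha>}"
    then obtain t where t: "\<beta> = t *\<^sub>R \<alpha>" by (auto simp: span_singleton)
    then have "t * N.g (r z) \<alpha> \<alpha> = 0"
      using metric(2) by (simp add: bilinear_lmul[OF N.bilinear[OF z(2)]])
    with pos(1) have "t = 0" by simp
    with t pos(2) show False
      using bilinear_lzero[OF N.bilinear[OF z(2)]] by simp
  qed
  have "\<alpha> \<noteq> 0"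
    using pos(1) bilinear_lzero[OF N.bilinear[OF z(2)]] by auto
  with notin have "independent {\<beta>, \<alpha>}" "\<beta> \<noteq> \<alpha>"
    using span_base[of \<alpha> "{\<alpha>}"] by (auto simp: independent_insert)
  then have "sectional_curvature N l (r z) \<beta> \<alpha> = c"
    using sec by (simp add: z_def)
  then have "N.g (r z) R \<beta> / (N.g (r z) \<beta> \<beta> * N.g (r z) \<alpha> \<alpha>) = c"
    by (simp add: sectional_curvature_def R metric(2))
  moreover have "s = c * u" if "s * t / (t * u) = c" "t > 0" "u > 0" for s t u :: real
    using that by (auto simp: field_simps)
  ultimately have "(Dh x p - frechet_derivative (\<lambda>x. Dh x a) (at x) a) / h x = c * B.g x a a"
    using pos unfolding R_eq bilinear_lmul[OF N.bilinear[OF z(2)]] metric(1)[symmetric]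
    by simp
  then show ?thesis
    using warping_pos[OF xy(1)] by (simp add: p_def field_simps)
qed

section \<open>From the Hessian to the Laplacian\<close>

lemma along_levi_civita_diff:
  assumes "riemannian_chart B i" "x \<in> T" "open T" "T \<subseteq> chart_img B i"
    and h: "smooth_on (chart_img B i) h" and X: "smooth_on T X"
  shows "along (levi_civita B i X X) h x - along X (along X h) x =
    frechet_derivative h (at x) (christoffel B i x (X x) (X x))
    - frechet_derivative (\<lambda>y. frechet_derivative h (at y) (X x)) (at x) (X x)"
proof -
  interpret riemannian_chart B i by fact
  have x: "x \<in> chart_img B i" using assms by auto
  \<comment> \<open>The term containing the derivative of \<open>X\<close> also occurs in
    \<open>along (levi_civita B i X X) h x\<close>. It cancels, and what is left depends on
    \<open>X\<close> only through \<open>X x\<close>, so the Hessian formula for constant vectors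
    applies to frames.\<close>
  have "((\<lambda>y. frechet_derivative h (at y) (X y)) has_derivative
      (\<lambda>u. frechet_derivative (\<lambda>y. frechet_derivative h (at y) (X x)) (at x) u
        + frechet_derivative h (at x) (frechet_derivative X (at x) u))) (at x)"
    by (rule has_derivative_linear_family[OF open_img x])
      (use h x smooth_on_imp_has_derivative[OF X assms(2)] in
        \<open>auto intro: linear_frechet_derivative_smooth_on smooth_on_imp_differentiable
          smooth_on_frechet_derivative\<close>)
  moreover have "along X h = (\<lambda>y. frechet_derivative h (at y) (X y))"
    by (simp add: along_def fun_eq_iff)
  ultimately show ?thesis
    using linear_add[OF linear_frechet_derivative_smooth_on[OF h x]]
    by (simp add: along_def levi_civita_def frechet_derivative_eqI)
qed

text \<open>The Laplacian is a choice among values from all charts and frames. Gram-Schmidt provides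
  at least one candidate, and if all candidates equal \<open>L\<close>, so does the chosen
  one.\<close>

lemma laplacian_eqI:
  assumes "riemannian_manifold B" "p \<in> carrier B"
    and "\<And>i T e. i \<in> charts B \<Longrightarrow> p \<in> chart_dom B i \<Longrightarrow> chart_map B i p \<in> T \<Longrightarrow>
      local_orthonormal_frame B i T e \<Longrightarrow>
      (\<Sum>k<DIM('e). along (levi_civita B i (e k) (e k)) (h \<circ> chart_inv B i) (chart_map B i p)
        - along (e k) (along (e k) (h \<circ> chart_inv B i)) (chart_map B i p)) = L"
  shows "laplacian (B :: ('i, 'p::{t2_space, second_countable_topology}, 'e::euclidean_space) rmanifold) h p = L"
proof -
  obtain i where i: "i \<in> charts B" "p \<in> chart_dom B i"
    using assms(2) by (auto simp: carrier_def)
  interpret riemannian_chart B i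
    using riemannian_chartI[OF assms(1) i(1)] .
  obtain e where e: "local_orthonormal_frame B i S e"
    by (rule orthonormal_frame_exists)
  have p: "chart_map B i p \<in> S" using i by (simp add: chart_img_def)
  show ?thesis
    unfolding laplacian_def
  proof (rule someI2_ex, goal_cases)
    case 1
    show ?case
      by (rule exI, rule exI[of _ i], rule exI[of _ S], rule exI[of _ e]) (use i p e in simp)
  next
    case (2 x)
    then show ?case
      using assms(3) by (elim exE conjE) (erule trans, blast)
  qed
qed

theorem corollary3p2:
  fixes B :: "('i, 'b::{t2_space, second_countable_topology}, 'eb::euclidean_space) rmanifold"
    and F :: "('j, 'f::{t2_space, second_countable_topology}, 'ef::euclidean_space) rmanifold"
    and f :: "'b \<Rightarrow> real"
    and N :: "('l, 'n::{t2_space, second_countable_topology}, 'en::euclidean_space) rmanifold"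
    and c :: real
    and \<psi> :: "'b \<times> 'f \<Rightarrow> 'n"
  assumes "riemannian_manifold B" and "riemannian_manifold F"
    and "smooth_function B f" and "\<forall>b\<in>carrier B. f b > 0"
    and "M = warped_product B f F"
    and "real_space_form c N"
    and "isometric_immersion M N \<psi>"
    and "totally_geodesic M N \<psi>"
  shows "\<forall>p\<in>carrier M.
           real DIM('eb) * c \<le> laplacian B f (fst p) / f (fst p) \<and>
           laplacian B f (fst p) / f (fst p) \<le> real DIM('eb) * c"
proof
  fix p assume "p \<in> carrier M"
  then obtain b q where p: "p = (b, q)" "b \<in> carrier B" "q \<in> carrier F"
    using assms(5) by (auto simp: carrier_def warped_product_simps)
  \<comment> \<open>Both bounds come from this single equality after division by the positive number
    \<open>f b\<close>.\<close>
  have "laplacian B f b = real DIM('eb) * c * f b"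
  proof (rule laplacian_eqI[OF assms(1) p(2)])
    fix i T and e :: "nat \<Rightarrow> 'eb \<Rightarrow> 'eb"
    assume i: "i \<in> charts B" "b \<in> chart_dom B i"
      and T: "chart_map B i b \<in> T" "local_orthonormal_frame B i T e"
    define x where "x = chart_map B i b"
    obtain j where j: "j \<in> charts F" "q \<in> chart_dom F j"
      using p(3) by (auto simp: carrier_def)
    have M: "(i, j) \<in> charts M" "p \<in> chart_dom M (i, j)" "p \<in> carrier M"
      using i j p \<open>p \<in> carrier M\<close> by (auto simp: assms(5) warped_product_simps)
    have map: "\<psi> ` carrier M \<subseteq> carrier N" "continuous_on (carrier M) \<psi>"
      using assms(7) by (auto simp: isometric_immersion_def smooth_map_def)
    then obtain l where l: "l \<in> charts N" "\<psi> p \<in> chart_dom N l"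
      using M(3) by (auto simp: carrier_def)
    have N: "riemannian_manifold N"
      using assms(6) by (simp add: real_space_form_def)
    have homeo: "open (chart_dom K i)" "open (chart_img K i)"
      "homeomorphism (chart_dom K i) (chart_img K i) (chart_map K i) (chart_inv K i)"
      if "riemannian_manifold K" "i \<in> charts K"
      for K :: "('x, 'y::{t2_space, second_countable_topology}, 'z::euclidean_space) rmanifold" and i
      using that by (auto simp: riemannian_manifold_def smooth_atlas_def)
    note hB = homeo[OF assms(1) i(1)] and hF = homeo[OF assms(2) j(1)] and hN = homeo[OF N l(1)]
    interpret B: riemannian_chart B i by (rule riemannian_chartI[OF assms(1) i(1)])
    interpret F: riemannian_chart F j by (rule riemannian_chartI[OF assms(2) j(1)])
    have inv: "chart_inv B i u \<in> carrier B" if "u \<in> chart_img B i" for u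
      using that i hB(3) by (auto simp: carrier_def homeomorphism_def)
    interpret warped_chart B i F j f
      by unfold_locales
        (use assms(3,4) i(1) inv in \<open>auto simp: smooth_function_def\<close>)
    define U where "U = local_dom M N \<psi> (i, j) l"
    define r where "r = local_rep M N \<psi> (i, j) l"
    define y where "y = chart_map F j q"
    have hM: "homeomorphism (chart_dom M (i, j)) (chart_img M (i, j)) (chart_map M (i, j)) (chart_inv M (i, j))"
      by (rule homeomorphism_chart_warped_product[OF hB(3) hF(3) assms(5)])
    have U: "open U"
      unfolding U_def
      by (rule open_local_dom[OF hM _ _ M(1) map(2) hN(1)])
        (use hB hF in \<open>auto simp: assms(5) warped_product_simps chart_img_warped_product open_Times\<close>)
    have "chart_map M (i, j) p = (x, y)"
      by (simp add: assms(5) warped_product_simps p x_def y_def)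
    then have xy: "(x, y) \<in> U"
      unfolding U_def local_dom_def using M(2) l(2) by force
    have "U \<subseteq> chart_img M (i, j)"
      by (auto simp: U_def local_dom_def chart_img_def)
    then have U_img: "U \<subseteq> chart_img B i \<times> chart_img F j"
      by (simp add: assms(5) chart_img_warped_product)
    have r: "smooth_on U r"
      using assms(7) M(1) l(1) by (auto simp: U_def r_def isometric_immersion_def smooth_map_def)
    have r_img: "r ` U \<subseteq> chart_img N l"
      using hM unfolding U_def r_def local_dom_def local_rep_def chart_img_def
      by (auto simp: homeomorphism_def)
    have iso: "chart_metric N l (r z) (frechet_derivative r (at z) v) (frechet_derivative r (at z) w) =
        chart_metric M (i, j) z v w" if "z \<in> U" for z v w
      using assms(7) M(1) l(1) that unfolding U_def r_def isometric_immersion_def Let_def by blast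
    have tg: "frechet_derivative (\<lambda>z. frechet_derivative r (at z) w) (at z) v =
        frechet_derivative r (at z) (christoffel M (i, j) z v w)
        - christoffel N l (r z) (frechet_derivative r (at z) v) (frechet_derivative r (at z) w)"
      if "z \<in> U" for z v w
    proof -
      \<comment> \<open>For constant fields the intrinsic and ambient covariant derivatives reduce
        to Christoffel terms, apart from the second derivative of \<open>r\<close>; the vanishing
        form can therefore be solved for that derivative.\<close>
      have "second_fundamental_form M N \<psi> (i, j) l (\<lambda>_. v) (\<lambda>_. w) z = 0"
        using assms(8) M(1) l(1) U that smooth_on_const unfolding totally_geodesic_def U_def by blast
      moreover have "along (\<lambda>_. w) r = (\<lambda>z. frechet_derivative r (at z) w)"
        by (simp add: along_def fun_eq_iff)
      ultimately show ?thesis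
        by (simp add: second_fundamental_form_def levi_civita_along_def levi_civita_def along_def
            algebra_simps flip: r_def)
    qed
    have sec: "sectional_curvature N l (r (x, y)) v w = c" if "v \<noteq> w" "independent {v, w}" for v w
      using assms(6) l(1) that r_img xy unfolding real_space_form_def by blast
    have hess: "Dh x (B.\<Gamma> x a a) - frechet_derivative (\<lambda>x. Dh x a) (at x) a = c * h x * B.g x a a" for a
      by (rule hessian_warping[OF riemannian_chartI[OF N l(1)] U xy U_img r r_img])
        (use iso[OF xy] tg sec in \<open>simp_all add: assms(5)\<close>)
    \<comment> \<open>Each frame vector has unit length at \<open>x\<close>, so it contributes
      \<open>c * f b\<close>; the sum over the frame brings in the dimension of the base.\<close>
    have "along (levi_civita B i (e k) (e k)) (f \<circ> chart_inv B i) x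
        - along (e k) (along (e k) (f \<circ> chart_inv B i)) x = c * f b" if k: "k < DIM('eb)" for k
    proof -
      have "along (levi_civita B i (e k) (e k)) h x - along (e k) (along (e k) h) x
          = c * h x * B.g x (e k x) (e k x)"
        using T k hess
        by (subst along_levi_civita_diff[OF B.riemannian_chart_axioms _ _ _ smooth_on_h, of x T])
          (auto simp: local_orthonormal_frame_def x_def)
      moreover have "B.g x (e k x) (e k x) = 1"
        using T k by (auto simp: local_orthonormal_frame_def x_def)
      moreover have "h x = f b"
        using hB(3) i(2) by (simp add: x_def homeomorphism_def)
      ultimately show ?thesis by (simp add: comp_def)
    qed
    then show "(\<Sum>k<DIM('eb). along (levi_civita B i (e k) (e k)) (f \<circ> chart_inv B i) (chart_map B i b)
        - along (e k) (along (e k) (f \<circ> chart_inv B i)) (chart_map B i b)) = real DIM('eb) * c * f b"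
      by (simp flip: x_def)
  qed
  moreover have "f b > 0" using assms(4) p(2) by blast
  ultimately show "real DIM('eb) * c \<le> laplacian B f (fst p) / f (fst p) \<and>
      laplacian B f (fst p) / f (fst p) \<le> real DIM('eb) * c"
    by (simp add: p(1))
qed

end
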